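(* Let $Q:=2\cdot(K_4^-)+2\cdot(\mathrm{paw})+P_4$. For all $\sigma$ with $\frac14(1+\sqrt2)\le\sigma\le1$ we have $I(Q,\sigma)=\mathrm{rand}(Q,\sigma)$, and also $I(Q)=\sup_{\sigma\in[0,1]}\mathrm{rand}(Q,\sigma)$. Moreover, for every such $\sigma$ and all $0<\delta<10^{-6}$ there exists $n_0$ such that whenever $n\ge n_0$ and $J$ is an $n$-vertex graph with $\sigma\binom n2$ edges and $I(Q,J)>(\mathrm{rand}(Q,\sigma)-\delta)\binom n4$, then $J$ is $(3\delta^{1/8})$-quasirandom of density $\sigma$.
   Context: Graphs are uncoloured here. $K_4^-$ is $K_4$ minus one edge; the paw is a triangle with a pendant edge attached to one of its vertices; $P_4$ is the path on four vertices (three edges). For a graph $F$ and a graph $J$, $I(F,J)$ is the number of $|V(F)|$-element vertex subsets $A$ of $J$ such that the induced subgraph $J[A]$ is isomorphic to $F$. For a formal combination $Q=\sum_i c_iF_i$ of graphs on the same number $k$ of vertices, $I(Q,J)=\sum_i c_i I(F_i,J)$, $I(Q,n)=\max_{|V(J)|=n}I(Q,J)$ and $I(Q)=\lim_{n\to\infty}I(Q,n)/\binom nk$. For $\sigma\in[0,1]$, $I(Q,\sigma)$ is the supremum of all $y$ such that there is a sequence of graphs $J_1,J_2,\dots$ with $a_n:=|V(J_n)|\to\infty$, $e(J_n)/\binom{a_n}2\to\sigma$ and $I(Q,J_n)/\binom{a_n}{k}\to y$. $\mathrm{rand}(Q,\sigma)=\lim_{n\to\infty}\mathbb E\left[I(Q,G_{n,\sigma})\right]/\binom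 nk$, where $G_{n,\sigma}$ is the binomial random graph in which each pair is an edge independently with probability $\sigma$. For $\varepsilon>0$, an $n$-vertex graph $J$ of density $\sigma=e(J)/\binom n2$ is $\varepsilon$-quasirandom if $\sum_{x\neq y}\left||N_J(x)\cap N_J(y)|-\sigma^2n\right|<\varepsilon n^3$ (sum over ordered pairs of distinct vertices). *)

theory Defs
  imports "HOL-Probability.Probability"
begin

text \<open>
  A finite simple graph is a pair of a finite vertex set and a set of two-element subsets of it.
\<close>

type_synonym 'a ugraph = "'a set \<times> 'a set set"

abbreviation verts :: "'a ugraph \<Rightarrow> 'a set" where
  "verts \<equiv> fst"

abbreviation edges :: "'a ugraph \<Rightarrow> 'a set set" where
  "edges \<equiv> snd"

definition all_pairs :: "'a set \<Rightarrow> 'a set set" where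
  "all_pairs V = {e. e \<subseteq> V \<and> card e = 2}"

definition simple_graph :: "'a ugraph \<Rightarrow> bool" where
  "simple_graph G \<longleftrightarrow> finite (verts G) \<and> edges G \<subseteq> all_pairs (verts G)"

definition induced :: "'a ugraph \<Rightarrow> 'a set \<Rightarrow> 'a ugraph" where
  "induced G A = (A, {e \<in> edges G. e \<subseteq> A})"

definition graph_iso :: "'a ugraph \<Rightarrow> 'b ugraph \<Rightarrow> bool" where
  "graph_iso G H \<longleftrightarrow> (\<exists>f. bij_betw f (verts G) (verts H) \<and>
     (\<forall>x\<in>verts G. \<forall>y\<in>verts G. {x, y} \<in> edges G \<longleftrightarrow> {f x, f y} \<in> edges H))"

definition nbhd :: "'a ugraph \<Rightarrow> 'a \<Rightarrow> 'a set" where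
  "nbhd G x = {y \<in> verts G. {x, y} \<in> edges G}"

definition edge_density :: "'a ugraph \<Rightarrow> real" where
  "edge_density G = real (card (edges G)) / real (card (verts G) choose 2)"

definition ind_count :: "'b ugraph \<Rightarrow> 'a ugraph \<Rightarrow> nat" where
  "ind_count F J =
     card {A. A \<subseteq> verts J \<and> card A = card (verts F) \<and> graph_iso (induced J A) F}"

text \<open>
  A formal linear combination is a list of coefficient-graph pairs. The common number \<open>k\<close> of
  vertices of the graphs in the combination is an explicit parameter of the quantities below.
\<close>

type_synonym graph_comb = "(real \<times> nat ugraph) list"

definition comb_count :: "graph_comb \<Rightarrow> 'a ugraph \<Rightarrow> real" where
  "comb_count Q J = (\<Sum>(c, F)\<leftarrow>Q. c * real (ind_count F J))"

text \<open>
  Up to isomorphism every finite graph has its vertices in \<^typ>\<open>nat\<close>. The set below is finite and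
  nonempty, as the values of \<^const>\<open>comb_count\<close> depend only on the isomorphism type.
\<close>

definition comb_max :: "graph_comb \<Rightarrow> nat \<Rightarrow> real" where
  "comb_max Q n =
     Max {comb_count Q J | J :: nat ugraph. simple_graph J \<and> card (verts J) = n}"

definition inducibility :: "nat \<Rightarrow> graph_comb \<Rightarrow> real" where
  "inducibility k Q = lim (\<lambda>n. comb_max Q n / real (n choose k))"

definition inducibility_at :: "nat \<Rightarrow> graph_comb \<Rightarrow> real \<Rightarrow> real" where
  "inducibility_at k Q \<sigma> = Sup {y. \<exists>J :: nat \<Rightarrow> nat ugraph.
     (\<forall>n. simple_graph (J n)) \<and>
     filterlim (\<lambda>n. card (verts (J n))) at_top sequentially \<and>
     (\<lambda>n. edge_density (J n)) \<longlonglongrightarrow> \<sigma> \<and>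
     (\<lambda>n. comb_count Q (J n) / real (card (verts (J n)) choose k)) \<longlonglongrightarrow> y}"

definition binomial_random_graph :: "nat \<Rightarrow> real \<Rightarrow> nat ugraph pmf" where
  "binomial_random_graph n \<sigma> =
     map_pmf (\<lambda>X. ({..<n}, {e \<in> all_pairs {..<n}. X e}))
       (Pi_pmf (all_pairs {..<n}) False (\<lambda>_. bernoulli_pmf \<sigma>))"

definition rand_density :: "nat \<Rightarrow> graph_comb \<Rightarrow> real \<Rightarrow> real" where
  "rand_density k Q \<sigma> =
     lim (\<lambda>n. measure_pmf.expectation (binomial_random_graph n \<sigma>) (comb_count Q)
                / real (n choose k))"

definition quasirandom :: "real \<Rightarrow> 'a ugraph \<Rightarrow> bool" where
  "quasirandom \<epsilon> J \<longleftrightarrow>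
     (\<Sum>x\<in>verts J. \<Sum>y\<in>verts J - {x}.
        \<bar>real (card (nbhd J x \<inter> nbhd J y)) - (edge_density J)\<^sup>2 * real (card (verts J))\<bar>)
     < \<epsilon> * real (card (verts J)) ^ 3"

definition K4_minus :: "nat ugraph" where
  "K4_minus = ({..<4}, all_pairs {..<4} - {{0, 1}})"

definition paw :: "nat ugraph" where
  "paw = ({..<4}, {{0, 1}, {1, 2}, {0, 2}, {2, 3}})"

definition P4 :: "nat ugraph" where
  "P4 = ({..<4}, {{0, 1}, {1, 2}, {2, 3}})"

definition Q_comb :: graph_comb where
  "Q_comb = [(2, K4_minus), (2, paw), (1, P4)]"

end

theory Submission
  imports Defs
begin

text \<open>
  Twice \<open>comb_count Q_comb J\<close> is the number of ordered quadruples \<open>(w, x, y, z)\<close> of distinct vertices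
  for which \<open>wx\<close>, \<open>xy\<close>, \<open>yz\<close> are edges and \<open>zw\<close> is not, whatever \<open>wy\<close> and \<open>xz\<close> are. Asymptotically it
  is therefore the density of the three-edge path minus that of the four-cycle, and
  the random value is \<open>12 \<sigma>\<^sup>3 (1 - \<sigma>)\<close>.

  Let \<open>D\<close> be the normalised degree with mean \<open>p\<close> and variance \<open>s\<close>, let \<open>c\<close> be the normalised
  codegree and \<open>k\<close> its row mean, whose mean is \<open>q = p\<^sup>2 + s\<close>. The path density is the mean of \<open>D k\<close> and
  the cycle density the mean of \<open>c\<^sup>2\<close>. Splitting \<open>c\<close> orthogonally into its mean, its row and column
  parts and a remainder \<open>S\<close>, and completing the square in \<open>k\<close>, the difference becomes
  \<open>p\<^sup>3 - p\<^sup>4 - (2p\<^sup>2 - p - 1/8) s - s\<^sup>2 - 2 M - T\<close>, where \<open>M\<close> is the mean of \<open>((k - q) - (D - p)/4)\<^sup>2\<close> and \<open>T\<close>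
  the mean of \<open>S\<^sup>2\<close>. The coefficient of \<open>s\<close> changes sign exactly at \<open>p = (1 + sqrt 2)/4\<close>; beyond
  this point the random graph is optimal, and near-optimality makes \<open>s\<close>, \<open>M\<close>, \<open>T\<close> small, hence
  \<open>c\<close> close to \<open>p\<^sup>2\<close>. Below it \<open>s\<^sup>2\<close> still keeps the difference under the global maximum \<open>27/256\<close>.
\<close>

section \<open>The path minus cycle identity\<close>

definition avg :: "'a set \<Rightarrow> ('a \<Rightarrow> real) \<Rightarrow> real" where
  "avg V f = (\<Sum>x\<in>V. f x) / real (card V)"

lemma avg_add: "avg V (\<lambda>x. f x + g x) = avg V f + avg V g"
  by (simp add: avg_def sum.distrib add_divide_distrib)

lemma avg_diff: "avg V (\<lambda>x. f x - g x) = avg V f - avg V g"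
  by (simp add: avg_def sum_subtractf diff_divide_distrib)

lemma avg_cmult: "avg V (\<lambda>x. c * f x) = c * avg V f"
  by (simp add: avg_def sum_distrib_left)

lemma avg_multc: "avg V (\<lambda>x. f x * c) = avg V f * c"
  by (simp add: avg_def sum_distrib_right)

lemma avg_divide: "avg V (\<lambda>x. f x / c) = avg V f / c"
  by (simp add: avg_def sum_divide_distrib mult.commute)

lemma avg_const: "finite V \<Longrightarrow> V \<noteq> {} \<Longrightarrow> avg V (\<lambda>x. c) = c"
  by (simp add: avg_def)

lemma avg_swap: "avg V (\<lambda>x. avg W (\<lambda>y. f x y)) = avg W (\<lambda>y. avg V (\<lambda>x. f x y))"
  unfolding avg_def by (simp add: sum_divide_distrib[symmetric] sum.swap[of _ W V] mult.commute)

lemma avg_mono: "(\<And>x. x \<in> V \<Longrightarrow> f x \<le> g x) \<Longrightarrow> avg V f \<le> avg V g"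
  by (simp add: avg_def divide_right_mono sum_mono)

lemma avg_nonneg: "(\<And>x. x \<in> V \<Longrightarrow> 0 \<le> f x) \<Longrightarrow> 0 \<le> avg V f"
  by (simp add: avg_def sum_nonneg)

lemmas avg_linear = avg_add avg_diff avg_cmult avg_multc avg_divide

text \<open>All averages run over arbitrary tuples, repeated vertices included, so the identity is
  exact. Everything is expressed through the moments \<open>q\<close>, \<open>K\<close>,
  \<open>P\<close>, \<open>C\<close> of degrees and codegrees, after which it is polynomial algebra.
  The second conclusion bounds the distance of the codegree from \<open>p ^ 2\<close> by the same
  \<open>s\<close>, \<open>M\<close>, \<open>T\<close>: when these losses are small, the codegree is
  nearly constant.\<close>

lemma path_minus_cycle_identity:
  fixes a :: "'a \<Rightarrow> 'a \<Rightarrow> real"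
  assumes V: "finite V" "V \<noteq> {}"
    and sym: "\<And>x y. a x y = a y x"
    and bounds: "\<And>x y. 0 \<le> a x y" "\<And>x y. a x y \<le> 1"
  defines "p \<equiv> avg V (\<lambda>x. avg V (a x))"
    and "c \<equiv> \<lambda>x y. avg V (\<lambda>z. a x z * a z y)"
  obtains s M T :: real
  where "0 \<le> s" "s \<le> 1" "0 \<le> M" "0 \<le> T"
    and "avg V (\<lambda>x. avg V (\<lambda>y. c x y * avg V (a y))) - avg V (\<lambda>x. avg V (\<lambda>y. (c x y)\<^sup>2))
         = p ^ 3 - p ^ 4 - (2 * p\<^sup>2 - p - 1 / 8) * s - s\<^sup>2 - 2 * M - T"
    and "avg V (\<lambda>x. avg V (\<lambda>y. (c x y - p\<^sup>2)\<^sup>2)) \<le> s\<^sup>2 + s / 4 + 4 * M + T"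
proof -
  define D where "D x = avg V (a x)" for x
  define k where "k x = avg V (c x)" for x
  define q where "q = avg V (\<lambda>x. (D x)\<^sup>2)"
  define K where "K = avg V (\<lambda>x. (k x)\<^sup>2)"
  define P where "P = avg V (\<lambda>x. D x * k x)"
  define C where "C = avg V (\<lambda>x. avg V (\<lambda>y. (c x y)\<^sup>2))"
  note lin = avg_linear avg_const[OF V]
  have p: "avg V D = p" by (simp add: p_def D_def[abs_def])
  have csym: "c x y = c y x" for x y
    unfolding c_def by (simp add: sym[of x] sym[of _ y] mult.commute)
  have k': "avg V (\<lambda>x. c x y) = k y" for y
    unfolding k_def by (subst csym) simp
  have D': "avg V (\<lambda>x. a x y) = D y" for y
    unfolding D_def by (subst sym) simp
  \<comment> \<open>Two-step walks from \<open>x\<close> grouped by their middle vertex. Averaging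
    over \<open>x\<close> as well then gives the mean square degree, which is why the mean of
    \<open>k\<close> is \<open>q\<close>.\<close>
  have k_walk: "k x = avg V (\<lambda>z. a x z * D z)" for x
  proof -
    have "k x = avg V (\<lambda>z. avg V (\<lambda>y. a x z * a z y))"
      unfolding k_def c_def by (rule avg_swap)
    then show ?thesis by (simp add: lin D_def)
  qed
  have q: "avg V k = q"
  proof -
    have "avg V k = avg V (\<lambda>z. avg V (\<lambda>x. a x z * D z))"
      unfolding k_walk by (rule avg_swap)
    then show ?thesis by (simp add: lin D' q_def power2_eq_square)
  qed
  have P: "avg V (\<lambda>x. avg V (\<lambda>y. c x y * avg V (a y))) = P"
    by (subst avg_swap) (simp add: lin k' P_def D_def mult.commute)
  have D01: "0 \<le> D x" "D x \<le> 1" for x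
    using avg_nonneg[of V "a x"] avg_mono[of V "a x" "\<lambda>_. 1"] bounds by (auto simp: D_def lin)
  define s where "s = q - p\<^sup>2"
  define H where "H = K - q\<^sup>2"
  define G where "G = P - p * q"
  have s_avg: "avg V (\<lambda>x. (D x - p)\<^sup>2) = s"
    by (simp add: power2_diff lin q_def[symmetric] p s_def) (simp add: power2_eq_square)
  \<comment> \<open>The slope \<open>t\<close> stays free because two values are used:
    \<open>1 / 4\<close> defines \<open>M\<close>, and \<open>1 / 2\<close> gives the lower bound
    \<open>half\<close>.\<close>
  have quad: "avg V (\<lambda>x. ((k x - q) - (D x - p) * t)\<^sup>2) = H - 2 * t * G + t\<^sup>2 * s" for t
  proof -
    have "((k x - q) - (D x - p) * t)\<^sup>2 = (k x)\<^sup>2 - 2 * t * (D x * k x) + t\<^sup>2 * (D x)\<^sup>2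
        + 2 * (p * t - q) * k x - 2 * t * (p * t - q) * D x + (p * t - q)\<^sup>2" for x
      by (simp add: power2_eq_square algebra_simps)
    then have "avg V (\<lambda>x. ((k x - q) - (D x - p) * t)\<^sup>2) = K - 2 * t * P + t\<^sup>2 * q
        + 2 * (p * t - q) * q - 2 * t * (p * t - q) * p + (p * t - q)\<^sup>2"
      by (simp only: lin K_def P_def q_def[symmetric] q p)
    then show ?thesis
      by (simp add: H_def G_def s_def power2_eq_square algebra_simps)
  qed
  \<comment> \<open>The path minus cycle difference contains \<open>H\<close> and \<open>G\<close>
    only through \<open>G - 2 * H\<close>. Completing the square forces the slope
    \<open>1 / 4\<close>, with \<open>G - 2 * H = s / 8 - 2 * M\<close>; this is the source of the
    \<open>1 / 8\<close> in the coefficient of \<open>s\<close>.\<close>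
  define M where "M = avg V (\<lambda>x. ((k x - q) - (D x - p) * (1 / 4))\<^sup>2)"
  define T where "T = avg V (\<lambda>x. avg V (\<lambda>y. (c x y - k x - k y + q)\<^sup>2))"
  have M: "M = H - G / 2 + s / 16"
    unfolding M_def quad by (simp add: power2_eq_square)
  \<comment> \<open>Twice this quantity equals \<open>s / 4 + 4 * M - 2 * H\<close>, so its sign
    lets \<open>M\<close> and \<open>s\<close> bound \<open>2 * H\<close> in the final
    estimate.\<close>
  have half: "0 \<le> H - G + s / 4"
    using quad[of "1/2"] avg_nonneg[of V "\<lambda>x. ((k x - q) - (D x - p) * (1 / 2))\<^sup>2"]
    by (simp add: power2_eq_square)
  \<comment> \<open>Pythagoras for the splitting of \<open>c\<close> into its mean, row part, column
    part and remainder: by symmetry the row and column parts both have square norm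
    \<open>H\<close>.\<close>
  have T: "T = C - q\<^sup>2 - 2 * H"
  proof -
    have "(c x y - k x - k y + q)\<^sup>2 = (c x y)\<^sup>2 - 2 * k x * c x y - 2 * (c x y * k y)
        + 2 * q * c x y + (k x)\<^sup>2 + 2 * k x * k y - 2 * q * k x + (k y)\<^sup>2 - 2 * q * k y + q\<^sup>2" for x y
      by (simp add: power2_eq_square algebra_simps)
    then have "T = C - avg V (\<lambda>x. 2 * k x * avg V (c x)) - 2 * avg V (\<lambda>x. avg V (\<lambda>y. c x y * k y))
        + 2 * q * avg V (\<lambda>x. avg V (c x)) + K + avg V (\<lambda>x. 2 * k x * avg V k) - 2 * q * avg V k + K
        - 2 * q * avg V k + q\<^sup>2"
      unfolding T_def by (simp only: lin C_def K_def)
    moreover have "avg V (\<lambda>x. 2 * k x * avg V (c x)) = 2 * K"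
    proof -
      have "2 * k x * avg V (c x) = 2 * (k x)\<^sup>2" for x
        by (simp add: k_def power2_eq_square)
      then show ?thesis by (simp only: lin K_def)
    qed
    moreover have "avg V (\<lambda>x. avg V (\<lambda>y. c x y * k y)) = K"
      by (subst avg_swap) (simp add: lin k' K_def power2_eq_square)
    moreover have "avg V (\<lambda>x. avg V (c x)) = q"
      using q by (simp add: k_def[abs_def])
    ultimately show ?thesis
      by (simp add: lin q H_def power2_eq_square algebra_simps)
  qed
  show thesis
  proof (rule that)
    show "0 \<le> s" using s_avg avg_nonneg[of V "\<lambda>x. (D x - p)\<^sup>2"] by simp
    have "q \<le> 1"
      unfolding q_def using avg_mono[of V "\<lambda>x. (D x)\<^sup>2" "\<lambda>_. 1"] D01
      by (simp add: lin power_le_one)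
    then show "s \<le> 1" by (simp add: s_def) (smt (verit) zero_le_power2)
    show "0 \<le> M" unfolding M_def by (rule avg_nonneg) simp
    show "0 \<le> T" unfolding T_def by (intro avg_nonneg) simp
    have q': "q = s + p\<^sup>2" by (simp add: s_def)
    have C': "C = T + q\<^sup>2 + 2 * H" using T by simp
    have P': "P = G + p * q" by (simp add: G_def)
    show "avg V (\<lambda>x. avg V (\<lambda>y. c x y * avg V (a y))) - avg V (\<lambda>x. avg V (\<lambda>y. (c x y)\<^sup>2))
         = p ^ 3 - p ^ 4 - (2 * p\<^sup>2 - p - 1 / 8) * s - s\<^sup>2 - 2 * M - T"
      unfolding P C_def[symmetric] C' P' M q'
      by (simp add: power2_eq_square power3_eq_cube power4_eq_xxxx algebra_simps)
    have "(c x y - p\<^sup>2)\<^sup>2 = (c x y)\<^sup>2 - 2 * p\<^sup>2 * c x y + p ^ 4" for x y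
      by (simp add: power2_eq_square power4_eq_xxxx algebra_simps)
    then have "avg V (\<lambda>x. avg V (\<lambda>y. (c x y - p\<^sup>2)\<^sup>2)) = C - 2 * p\<^sup>2 * avg V (\<lambda>x. avg V (c x)) + p ^ 4"
      by (simp only: lin C_def)
    also have "avg V (\<lambda>x. avg V (c x)) = q"
      using q by (simp add: k_def[abs_def])
    finally have "avg V (\<lambda>x. avg V (\<lambda>y. (c x y - p\<^sup>2)\<^sup>2)) = s\<^sup>2 + 2 * H + T"
      unfolding C' q' by (simp add: power2_eq_square power4_eq_xxxx algebra_simps)
    then show "avg V (\<lambda>x. avg V (\<lambda>y. (c x y - p\<^sup>2)\<^sup>2)) \<le> s\<^sup>2 + s / 4 + 4 * M + T"
      using half by (simp add: M)
  qed
qed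

section \<open>Counting paths with nonadjacent ends\<close>

text \<open>Four elements that exhaust a four-element set must be distinct. This turns statements
  about listings of \<open>A\<close> into nested bounded quantifiers, which can be expanded over
  explicit elements.\<close>

lemma quadruple_set_eq_iff:
  assumes "card A = 4"
  shows "{w, x, y, z} = A \<longleftrightarrow> w \<in> A \<and> x \<in> A - {w} \<and> y \<in> A - {w, x} \<and> z \<in> A - {w, x, y}"
proof
  assume *: "{w, x, y, z} = A"
  have "distinct [w, x, y, z]"
    using assms card_distinct[of "[w, x, y, z]"] by (simp add: *)
  with * show "w \<in> A \<and> x \<in> A - {w} \<and> y \<in> A - {w, x} \<and> z \<in> A - {w, x, y}" by auto
next
  assume *: "w \<in> A \<and> x \<in> A - {w} \<and> y \<in> A - {w, x} \<and> z \<in> A - {w, x, y}"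
  then have "card {w, x, y, z} = 4" by (auto simp: card_insert_if)
  moreover have "{w, x, y, z} \<subseteq> A" using * by auto
  moreover have "finite A" using assms card.infinite by fastforce
  ultimately show "{w, x, y, z} = A" by (simp add: assms card_subset_eq)
qed

lemma lessThan_4: "{..<4::nat} = {0, 1, 2, 3}"
  by auto

text \<open>An isomorphism onto a graph on \<open>{..<4}\<close> amounts to a listing of
  \<open>A\<close>. Loops are absent on both sides, so only the six pairs of distinct vertices have
  to be compared.\<close>

lemma graph_iso_induced_four:
  assumes J: "simple_graph J" and A: "card A = 4" and E: "E \<subseteq> all_pairs {..<4::nat}"
  shows "graph_iso (induced J A) ({..<4}, E) \<longleftrightarrow>
    (\<exists>w x y z. {w, x, y, z} = A \<and>
       ({w, x} \<in> edges J \<longleftrightarrow> {0, 1} \<in> E) \<and> ({w, y} \<in> edges J \<longleftrightarrow> {0, 2} \<in> E) \<and>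
       ({w, z} \<in> edges J \<longleftrightarrow> {0, 3} \<in> E) \<and> ({x, y} \<in> edges J \<longleftrightarrow> {1, 2} \<in> E) \<and>
       ({x, z} \<in> edges J \<longleftrightarrow> {1, 3} \<in> E) \<and> ({y, z} \<in> edges J \<longleftrightarrow> {2, 3} \<in> E))"
    (is "?L \<longleftrightarrow> ?R")
proof
  assume ?L
  then obtain f where f: "bij_betw f A {..<4}"
    and fE: "\<And>u v. u \<in> A \<Longrightarrow> v \<in> A \<Longrightarrow> {u, v} \<in> edges J \<longleftrightarrow> {f u, f v} \<in> E"
    by (auto simp: graph_iso_def induced_def)
  define g where "g = the_inv_into A f"
  have g: "bij_betw g {..<4} A" unfolding g_def by (rule bij_betw_the_inv_into[OF f])
  then have img: "g ` {..<4} = A" by (rule bij_betw_imp_surj_on)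
  have fg: "f (g i) = i" if "i < 4" for i
    unfolding g_def using f that by (simp add: f_the_inv_into_f_bij_betw)
  have "{g i, g j} \<in> edges J \<longleftrightarrow> {i, j} \<in> E" if "i < 4" "j < 4" for i j
    using fE[of "g i" "g j"] that img fg by force
  moreover have "{g 0, g 1, g 2, g 3} = A" using img by (simp add: lessThan_4)
  ultimately show ?R
    by (intro exI[of _ "g 0"] exI[of _ "g 1"] exI[of _ "g 2"] exI[of _ "g 3"]) simp
next
  assume ?R
  then obtain w x y z where A_eq: "{w, x, y, z} = A" and
    e: "{w, x} \<in> edges J \<longleftrightarrow> {0, 1} \<in> E" "{w, y} \<in> edges J \<longleftrightarrow> {0, 2} \<in> E"
       "{w, z} \<in> edges J \<longleftrightarrow> {0, 3} \<in> E" "{x, y} \<in> edges J \<longleftrightarrow> {1, 2} \<in> E"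
       "{x, z} \<in> edges J \<longleftrightarrow> {1, 3} \<in> E" "{y, z} \<in> edges J \<longleftrightarrow> {2, 3} \<in> E"
    by blast
  have d: "w \<noteq> x" "w \<noteq> y" "w \<noteq> z" "x \<noteq> y" "x \<noteq> z" "y \<noteq> z"
    using A_eq[unfolded quadruple_set_eq_iff[OF A]] by auto
  define f where "f u = (if u = w then 0 else if u = x then 1 else if u = y then 2 else 3::nat)" for u
  have f: "f w = 0" "f x = 1" "f y = 2" "f z = 3" using d by (auto simp: f_def)
  have loop: "{u} \<notin> edges J" "{i} \<notin> E" for u i
    using J E by (auto simp: simple_graph_def all_pairs_def)
  have "bij_betw f A {..<4}"
  proof -
    have "f ` A = {..<4}" unfolding A_eq[symmetric] lessThan_4 by (simp only: image_insert image_empty f)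
    moreover have "finite A" using A_eq by blast
    ultimately show ?thesis
      unfolding bij_betw_def using A by (auto intro: eq_card_imp_inj_on)
  qed
  moreover have "\<forall>u\<in>A. \<forall>v\<in>A. {u, v} \<in> edges J \<longleftrightarrow> {f u, f v} \<in> E"
  proof -
    note comm = insert_commute[of x w] insert_commute[of y w] insert_commute[of z w]
      insert_commute[of y x] insert_commute[of z x] insert_commute[of z y]
      insert_commute[of "1::nat" 0] insert_commute[of "2::nat" 0] insert_commute[of "3::nat" 0]
      insert_commute[of "2::nat" 1] insert_commute[of "3::nat" 1] insert_commute[of "3::nat" 2]
    show ?thesis
      unfolding A_eq[symmetric] by (simp add: loop) (simp only: f comm e simp_thms)
  qed
  ultimately show ?L
    unfolding graph_iso_def induced_def by (intro exI[of _ f]) auto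
qed

definition open_path :: "'a ugraph \<Rightarrow> 'a \<times> 'a \<times> 'a \<times> 'a \<Rightarrow> bool" where
  "open_path J = (\<lambda>(w, x, y, z). {w, x} \<in> edges J \<and> {x, y} \<in> edges J \<and> {y, z} \<in> edges J \<and> {z, w} \<notin> edges J)"

definition quads :: "'a set \<Rightarrow> ('a \<times> 'a \<times> 'a \<times> 'a) set" where
  "quads V = {(w, x, y, z). w \<in> V \<and> x \<in> V - {w} \<and> y \<in> V - {w, x} \<and> z \<in> V - {w, x, y}}"

lemma quads_Sigma:
  "quads V = (SIGMA w:V. SIGMA x:V - {w}. SIGMA y:V - {w, x}. V - {w, x, y})"
  by (auto simp: quads_def)

lemma sum_quads:
  assumes "finite V"
  shows "(\<Sum>t\<in>quads V. f t) = (\<Sum>w\<in>V. \<Sum>x\<in>V - {w}. \<Sum>y\<in>V - {w, x}. \<Sum>z\<in>V - {w, x, y}. f (w, x, y, z))"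
  unfolding quads_Sigma using assms by (simp add: sum.Sigma case_prod_beta)

lemma finite_quads: "finite V \<Longrightarrow> finite (quads V)"
  by (auto simp: quads_Sigma)

lemma edges_K4_minus: "edges K4_minus = {{0,2},{0,3},{1,2},{1,3},{2,3}}"
proof -
  have "all_pairs {..<4::nat} = {{0,1},{0,2},{0,3},{1,2},{1,3},{2,3}}" (is "?l = ?r")
  proof
    show "?r \<subseteq> ?l" by (simp add: all_pairs_def)
    show "?l \<subseteq> ?r"
    proof
      fix e assume "e \<in> ?l"
      then obtain u v where "e = {u, v}" "u \<noteq> v" "u \<in> {0,1,2,3}" "v \<in> {0,1,2,3}"
        by (auto simp: all_pairs_def card_2_iff lessThan_4)
      then show "e \<in> ?r" by (elim insertE emptyE) (simp_all add: doubleton_eq_iff)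
    qed
  qed
  then show ?thesis by (auto simp: K4_minus_def doubleton_eq_iff)
qed

text \<open>The induced graph depends on the two free pairs \<open>wy\<close> and \<open>xz\<close>:
  with none, one or both present it is a \<open>P4\<close>, a \<open>paw\<close> or a
  \<open>K4_minus\<close>. Conversely \<open>P4\<close> contains one such path, the paw one for each
  of its two nonadjacent pairs, and \<open>K4_minus\<close> two for its single nonadjacent pair.
  Each path is counted in both directions, whence 2, 4 and 4.\<close>

lemma open_path_count_four:
  fixes J :: "'a ugraph"
  assumes J: "simple_graph J" and A: "card A = 4"
  shows "(\<Sum>t\<in>quads A. of_bool (open_path J t) :: real) =
      4 * of_bool (graph_iso (induced J A) K4_minus) + 4 * of_bool (graph_iso (induced J A) paw)
      + 2 * of_bool (graph_iso (induced J A) P4)"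
proof -
  obtain a b c d where A_eq: "A = {a, b, c, d}" and dis: "distinct [a, b, c, d]"
  proof -
    obtain xs where "set xs = A" "distinct xs" "length xs = 4"
      using A finite_distinct_list[of A] by (metis card.infinite distinct_card zero_neq_numeral)
    then show ?thesis using that by (auto simp: numeral_eq_Suc length_Suc_conv)
  qed
  define r where "r u v \<longleftrightarrow> {u, v} \<in> edges J" for u v
  have r: "r b a = r a b" "r c a = r a c" "r d a = r a d" "r c b = r b c" "r d b = r b d" "r d c = r c d"
    by (simp_all add: r_def insert_commute)
  have ex: "(\<exists>w x y z. {w, x, y, z} = A \<and> R w x y z) \<longleftrightarrow>
      (\<exists>w\<in>A. \<exists>x\<in>A - {w}. \<exists>y\<in>A - {w, x}. \<exists>z\<in>A - {w, x, y}. R w x y z)" for R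
    unfolding quadruple_set_eq_iff[OF A] by blast
  have fin: "finite A" by (simp add: A_eq)
  have ne: "a \<noteq> b" "a \<noteq> c" "a \<noteq> d" "b \<noteq> c" "b \<noteq> d" "c \<noteq> d"
           "b \<noteq> a" "c \<noteq> a" "d \<noteq> a" "c \<noteq> b" "d \<noteq> b" "d \<noteq> c" using dis by auto
  have K: "graph_iso (induced J A) K4_minus \<longleftrightarrow>
     (\<exists>w\<in>A. \<exists>x\<in>A - {w}. \<exists>y\<in>A - {w, x}. \<exists>z\<in>A - {w, x, y}.
        \<not> r w x \<and> r w y \<and> r w z \<and> r x y \<and> r x z \<and> r y z)"
    unfolding K4_minus_def
    by (subst graph_iso_induced_four[OF J A])
       (simp_all add: ex r_def edges_K4_minus[unfolded K4_minus_def snd_conv] all_pairs_def doubleton_eq_iff)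
  have Pw: "graph_iso (induced J A) paw \<longleftrightarrow>
     (\<exists>w\<in>A. \<exists>x\<in>A - {w}. \<exists>y\<in>A - {w, x}. \<exists>z\<in>A - {w, x, y}.
        r w x \<and> r w y \<and> \<not> r w z \<and> r x y \<and> \<not> r x z \<and> r y z)"
    unfolding paw_def
    by (subst graph_iso_induced_four[OF J A])
       (simp_all add: ex r_def doubleton_eq_iff all_pairs_def)
  have P: "graph_iso (induced J A) P4 \<longleftrightarrow>
     (\<exists>w\<in>A. \<exists>x\<in>A - {w}. \<exists>y\<in>A - {w, x}. \<exists>z\<in>A - {w, x, y}.
        r w x \<and> \<not> r w y \<and> \<not> r w z \<and> r x y \<and> \<not> r x z \<and> r y z)"
    unfolding P4_def
    by (subst graph_iso_induced_four[OF J A])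
       (simp_all add: ex r_def doubleton_eq_iff all_pairs_def)
  have sum: "(\<Sum>t\<in>quads A. f t) =
      f (a, b, c, d) + f (a, b, d, c) + f (a, c, b, d) + f (a, c, d, b) +
      f (a, d, b, c) + f (a, d, c, b) + f (b, a, c, d) + f (b, a, d, c) +
      f (b, c, a, d) + f (b, c, d, a) + f (b, d, a, c) + f (b, d, c, a) +
      f (c, a, b, d) + f (c, a, d, b) + f (c, b, a, d) + f (c, b, d, a) +
      f (c, d, a, b) + f (c, d, b, a) + f (d, a, b, c) + f (d, a, c, b) +
      f (d, b, a, c) + f (d, b, c, a) + f (d, c, a, b) + f (d, c, b, a)"
    for f :: "'a \<times> 'a \<times> 'a \<times> 'a \<Rightarrow> real"
    unfolding sum_quads[OF fin] unfolding A_eq by (simp add: ne insert_Diff_if)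
  have ex4: "(\<exists>w\<in>A. \<exists>x\<in>A - {w}. \<exists>y\<in>A - {w, x}. \<exists>z\<in>A - {w, x, y}. R w x y z) \<longleftrightarrow>
      R a b c d \<or> R a b d c \<or> R a c b d \<or> R a c d b \<or>
      R a d b c \<or> R a d c b \<or> R b a c d \<or> R b a d c \<or>
      R b c a d \<or> R b c d a \<or> R b d a c \<or> R b d c a \<or>
      R c a b d \<or> R c a d b \<or> R c b a d \<or> R c b d a \<or>
      R c d a b \<or> R c d b a \<or> R d a b c \<or> R d a c b \<or>
      R d b a c \<or> R d b c a \<or> R d c a b \<or> R d c b a"
    for R
    unfolding A_eq by (simp add: ne insert_Diff_if)
  \<comment> \<open>Symmetry of \<open>r\<close> leaves six independent adjacencies; the 64 patterns
    are checked one by one.\<close>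
  show ?thesis
    unfolding K Pw P sum ex4 open_path_def prod.case r_def[symmetric] r
    by (cases "r a b"; cases "r a c"; cases "r a d"; cases "r b c"; cases "r b d"; cases "r c d";
        simp only: simp_thms of_bool_eq; simp)
qed

lemma ind_count_eq_sum:
  assumes "finite (verts J)" "card (verts F) = 4"
  shows "real (ind_count F J) =
    (\<Sum>A\<in>{A. A \<subseteq> verts J \<and> card A = 4}. of_bool (graph_iso (induced J A) F))"
proof -
  have "finite {A. A \<subseteq> verts J \<and> card A = 4}" using assms(1) by simp
  then show ?thesis
    unfolding ind_count_def assms(2) by (simp add: of_bool_def sum.If_cases Int_def conj_ac)
qed

text \<open>Quadruples are grouped by their underlying vertex set. The weights 4, 4, 2 on a single
  set are twice the coefficients 2, 2, 1 of \<open>Q_comb\<close>.\<close>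

lemma comb_count_eq_open_path_count:
  assumes J: "simple_graph J"
  shows "comb_count Q_comb J = (\<Sum>t\<in>quads (verts J). of_bool (open_path J t)) / 2"
proof -
  let ?V = "verts J"
  let ?T = "{A. A \<subseteq> ?V \<and> card A = 4}"
  define S :: "'a \<times> 'a \<times> 'a \<times> 'a \<Rightarrow> 'a set" where "S = (\<lambda>(w, x, y, z). {w, x, y, z})"
  have fin: "finite ?V" using J by (simp add: simple_graph_def)
  have S_card: "S ` quads ?V \<subseteq> ?T"
    by (auto simp: S_def quads_def card_insert_if)
  have group: "{t \<in> quads ?V. S t = A} = quads A" if "A \<in> ?T" for A
  proof -
    have A: "card A = 4" "A \<subseteq> ?V" using that by auto
    have "t \<in> quads A \<longleftrightarrow> t \<in> quads ?V \<and> S t = A" for t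
    proof (cases t)
      case (fields w x y z)
      have "t \<in> quads A \<longleftrightarrow> S t = A"
        unfolding fields S_def quads_def by (simp add: quadruple_set_eq_iff[OF A(1)])
      moreover have "t \<in> quads A \<Longrightarrow> t \<in> quads ?V"
        using A(2) unfolding fields quads_def by auto
      ultimately show ?thesis by blast
    qed
    then show ?thesis by blast
  qed
  have "(\<Sum>t\<in>quads ?V. of_bool (open_path J t)) =
      (\<Sum>A\<in>?T. \<Sum>t\<in>{t \<in> quads ?V. S t = A}. of_bool (open_path J t) :: real)"
    using fin by (intro sum.group[symmetric] finite_quads S_card) auto
  also have "\<dots> = (\<Sum>A\<in>?T. \<Sum>t\<in>quads A. of_bool (open_path J t))"
    by (intro sum.cong refl) (simp only: group)
  also have "\<dots> = (\<Sum>A\<in>?T. 4 * of_bool (graph_iso (induced J A) K4_minus)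
      + 4 * of_bool (graph_iso (induced J A) paw) + 2 * of_bool (graph_iso (induced J A) P4))"
    by (intro sum.cong refl open_path_count_four[OF J]) auto
  also have "\<dots> = 4 * real (ind_count K4_minus J) + 4 * real (ind_count paw J) + 2 * real (ind_count P4 J)"
  proof -
    have "card (verts K4_minus) = 4" "card (verts paw) = 4" "card (verts P4) = 4"
      by (simp_all add: K4_minus_def paw_def P4_def)
    then show ?thesis
      using fin by (simp only: ind_count_eq_sum sum.distrib sum_distrib_left)
  qed
  finally show ?thesis by (simp add: comb_count_def Q_comb_def)
qed

section \<open>Pair density and the identity applied to graphs\<close>

lemma sum_edge_indicator:
  assumes J: "simple_graph J"
  shows "(\<Sum>x\<in>verts J. \<Sum>y\<in>verts J. of_bool ({x, y} \<in> edges J)) = 2 * real (card (edges J))"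
proof -
  let ?V = "verts J" and ?E = "edges J"
  let ?P = "{(x, y) \<in> ?V \<times> ?V. {x, y} \<in> ?E}"
  define S :: "'a \<times> 'a \<Rightarrow> 'a set" where "S = (\<lambda>(x, y). {x, y})"
  have fin: "finite ?V" using J by (simp add: simple_graph_def)
  have E: "?E \<subseteq> Pow ?V" using J by (auto simp: simple_graph_def all_pairs_def)
  have finE: "finite ?E" using fin E finite_subset by blast
  have finP: "finite ?P" using fin by (auto intro: finite_subset[of _ "?V \<times> ?V"])
  have fib: "card {t \<in> ?P. S t = e} = 2" if "e \<in> ?E" for e
  proof -
    from that J obtain u v where e: "e = {u, v}" "u \<noteq> v" "u \<in> ?V" "v \<in> ?V"
      by (auto simp: simple_graph_def all_pairs_def card_2_iff)
    have "{t \<in> ?P. S t = e} = {(u, v), (v, u)}"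
      using e that by (auto simp: S_def doubleton_eq_iff insert_commute)
    with e show ?thesis by simp
  qed
  have "(\<Sum>x\<in>?V. \<Sum>y\<in>?V. of_bool ({x, y} \<in> ?E) :: real) = (\<Sum>t\<in>?V \<times> ?V. of_bool (t \<in> ?P))"
    by (auto simp: sum.cartesian_product intro!: sum.cong)
  also have "\<dots> = (\<Sum>t\<in>?P. 1)"
    using fin by (intro sum.mono_neutral_cong_right) auto
  also have "\<dots> = (\<Sum>e\<in>?E. \<Sum>t\<in>{t \<in> ?P. S t = e}. 1)"
    by (rule sum.group[symmetric]) (use finP finE in \<open>auto simp: S_def\<close>)
  also have "\<dots> = 2 * real (card ?E)" using fib by simp
  finally show ?thesis .
qed

text \<open>The mean of the adjacency matrix with its zero diagonal included. This, and not
  \<open>edge_density\<close>, is the \<open>p\<close> of the analytic identity; the two differ by a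
  factor \<open>1 - 1 / n\<close>.\<close>

definition pair_density :: "'a ugraph \<Rightarrow> real" where
  "pair_density J = 2 * real (card (edges J)) / (real (card (verts J)))\<^sup>2"

lemma pair_density_eq:
  assumes "card (verts J) \<ge> 2"
  shows "pair_density J = edge_density J * (1 - 1 / real (card (verts J)))"
proof -
  define n where "n = card (verts J)"
  have *: "real (n choose 2) = real n * (real n - 1) / 2"
    using assms by (simp add: n_def choose_two real_of_nat_div)
  have "real n \<noteq> 0" "real n - 1 \<noteq> 0" using assms by (auto simp: n_def)
  then show ?thesis
    unfolding pair_density_def edge_density_def n_def[symmetric] *
    by (simp add: divide_simps power2_eq_square)
qed

lemma pair_density_nonneg: "0 \<le> pair_density J"
  by (simp add: pair_density_def)

text \<open>Allowing degenerate quadruples only adds nonnegative terms, so the count is at most a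
  full fourfold average. That average is the path density minus the cycle density of the adjacency
  matrix, to which the identity applies.\<close>

lemma comb_count_deficit:
  assumes J: "simple_graph J" and ne: "verts J \<noteq> {}"
  defines "n \<equiv> real (card (verts J))" and "p \<equiv> pair_density J"
  obtains s M T :: real
  where "0 \<le> s" "s \<le> 1" "0 \<le> M" "0 \<le> T"
    and "comb_count Q_comb J
         \<le> n ^ 4 / 2 * (p ^ 3 - p ^ 4 - (2 * p\<^sup>2 - p - 1 / 8) * s - s\<^sup>2 - 2 * M - T)"
    and "avg (verts J) (\<lambda>x. avg (verts J) (\<lambda>y. (real (card (nbhd J x \<inter> nbhd J y)) / n - p\<^sup>2)\<^sup>2))
         \<le> s\<^sup>2 + s / 4 + 4 * M + T"
proof -
  let ?V = "verts J"
  define a :: "'a \<Rightarrow> 'a \<Rightarrow> real" where "a x y = of_bool ({x, y} \<in> edges J)" for x y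
  define c where "c x y = avg ?V (\<lambda>z. a x z * a z y)" for x y
  have fin: "finite ?V" using J by (simp add: simple_graph_def)
  have n0: "n > 0" using fin ne by (simp add: n_def card_gt_0_iff)
  have sym: "a x y = a y x" for x y by (simp add: a_def insert_commute)
  have bd: "0 \<le> a x y" "a x y \<le> 1" for x y by (simp_all add: a_def)
  have p: "avg ?V (\<lambda>x. avg ?V (a x)) = p"
    using sum_edge_indicator[OF J]
    by (simp add: avg_def p_def pair_density_def a_def sum_divide_distrib[symmetric] power2_eq_square)
  have csym: "c x y = c y x" for x y
    unfolding c_def by (simp add: sym[of x] sym[of _ y] mult.commute)
  have codeg: "real (card (nbhd J x \<inter> nbhd J y)) / n = c x y" for x y
  proof -
    have "nbhd J x \<inter> nbhd J y = {z \<in> ?V. {x, z} \<in> edges J \<and> {z, y} \<in> edges J}"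
      by (auto simp: nbhd_def insert_commute)
    then have "real (card (nbhd J x \<inter> nbhd J y)) = (\<Sum>z\<in>?V. a x z * a z y)"
      using fin by (simp add: a_def of_bool_conj[symmetric] sum_of_bool_eq Int_def)
    then show ?thesis by (simp add: c_def avg_def n_def)
  qed
  define f where "f w x y z = a w x * a x y * (a y z * (1 - a z w))" for w x y z
  have f0: "0 \<le> f w x y z" for w x y z using bd by (simp add: f_def)
  have "(\<Sum>t\<in>quads ?V. of_bool (open_path J t)) = (\<Sum>t\<in>quads ?V. (\<lambda>(w, x, y, z). f w x y z) t)"
    by (intro sum.cong refl) (auto simp: open_path_def f_def a_def)
  also have "\<dots> \<le> (\<Sum>t\<in>?V \<times> ?V \<times> ?V \<times> ?V. (\<lambda>(w, x, y, z). f w x y z) t)"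
    using fin f0 by (intro sum_mono2) (auto simp: quads_def)
  also have "\<dots> = (\<Sum>w\<in>?V. \<Sum>x\<in>?V. \<Sum>y\<in>?V. \<Sum>z\<in>?V. f w x y z)"
    by (simp only: sum.cartesian_product)
  also have "\<dots> = n ^ 4 * avg ?V (\<lambda>w. avg ?V (\<lambda>x. avg ?V (\<lambda>y. avg ?V (\<lambda>z. f w x y z))))"
    using n0 by (simp add: avg_def n_def[symmetric] sum_divide_distrib[symmetric] power4_eq_xxxx)
  \<comment> \<open>The average over \<open>z\<close> turns the last two factors into degree minus
    codegree. After the order is exchanged, the average over \<open>x\<close> turns the first two
    into the codegree \<open>c w y\<close>.\<close>
  also have "avg ?V (\<lambda>w. avg ?V (\<lambda>x. avg ?V (\<lambda>y. avg ?V (\<lambda>z. f w x y z))))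
      = avg ?V (\<lambda>w. avg ?V (\<lambda>x. avg ?V (\<lambda>y. a w x * a x y * (avg ?V (a y) - c y w))))"
    by (simp add: f_def right_diff_distrib avg_linear c_def)
  also have "\<dots> = avg ?V (\<lambda>w. avg ?V (\<lambda>y. avg ?V (\<lambda>x. a w x * a x y * (avg ?V (a y) - c y w))))"
    by (subst avg_swap) simp
  also have "\<dots> = avg ?V (\<lambda>w. avg ?V (\<lambda>y. c w y * (avg ?V (a y) - c w y)))"
    by (simp only: avg_multc c_def[symmetric] csym)
  also have "\<dots> = avg ?V (\<lambda>w. avg ?V (\<lambda>y. c w y * avg ?V (a y)))
      - avg ?V (\<lambda>w. avg ?V (\<lambda>y. (c w y)\<^sup>2))"
    by (simp add: right_diff_distrib avg_diff power2_eq_square)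
  finally have le: "comb_count Q_comb J \<le> n ^ 4 / 2 * \<dots>"
    unfolding comb_count_eq_open_path_count[OF J] by simp
  show thesis
  proof (rule path_minus_cycle_identity[of ?V a, OF fin ne sym bd, unfolded p c_def[symmetric]])
    fix s M T :: real
    assume *: "0 \<le> s" "s \<le> 1" "0 \<le> M" "0 \<le> T"
      "avg ?V (\<lambda>x. avg ?V (\<lambda>y. c x y * avg ?V (a y))) - avg ?V (\<lambda>x. avg ?V (\<lambda>y. (c x y)\<^sup>2))
         = p ^ 3 - p ^ 4 - (2 * p\<^sup>2 - p - 1 / 8) * s - s\<^sup>2 - 2 * M - T"
      "avg ?V (\<lambda>x. avg ?V (\<lambda>y. (c x y - p\<^sup>2)\<^sup>2)) \<le> s\<^sup>2 + s / 4 + 4 * M + T"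
    show thesis
      by (rule that[OF *(1-4)]) (use le * in \<open>simp_all only: codeg\<close>)
  qed
qed

section \<open>Upper bounds and stability\<close>

lemma power4_over_choose_tendsto: "(\<lambda>n. real n ^ 4 / real (n choose 4)) \<longlonglongrightarrow> 24"
proof -
  have "(\<lambda>n. 24 / ((1 - 1 / real n) * (1 - 2 * (1 / real n)) * (1 - 3 * (1 / real n))))
      \<longlonglongrightarrow> 24 / ((1 - 0) * (1 - 2 * 0) * (1 - 3 * 0))"
    by (intro tendsto_intros lim_1_over_n) auto
  moreover have "eventually (\<lambda>n. 24 / ((1 - 1 / real n) * (1 - 2 * (1 / real n)) * (1 - 3 * (1 / real n)))
      = real n ^ 4 / real (n choose 4)) sequentially"
    using eventually_ge_at_top[of 4]
  proof eventually_elim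
    case (elim n)
    have "real (n choose 4) = real n * (real n - 1) * (real n - 2) * (real n - 3) / 24"
      using elim by (simp add: binomial_gbinomial gbinomial_prod_rev numeral_eq_Suc fact_numeral algebra_simps)
    moreover have "real n \<noteq> 0" "real n \<noteq> 1" "real n \<noteq> 2" "real n \<noteq> 3" using elim by auto
    ultimately show ?case by (simp add: divide_simps power4_eq_xxxx)
  qed
  ultimately show ?thesis by (simp add: tendsto_cong)
qed

text \<open>The pair density of a finite graph may fall slightly below the threshold, where the
  coefficient of \<open>s\<close> helps the count. Since \<open>s\<close> is at most 1, the gain is
  at most the \<open>max\<close> term, which vanishes in the limit when the limiting density is at
  or above the threshold.\<close>

lemma comb_count_le_density_bound:
  assumes J: "simple_graph J" "verts J \<noteq> {}"
  defines "p \<equiv> pair_density J"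
  shows "comb_count Q_comb J
    \<le> real (card (verts J)) ^ 4 / 2 * (p ^ 3 - p ^ 4 + max 0 (1 / 8 + p - 2 * p\<^sup>2))"
proof (rule comb_count_deficit[OF J], fold p_def)
  fix s M T :: real
  assume *: "0 \<le> s" "s \<le> 1" "0 \<le> M" "0 \<le> T"
    and le: "comb_count Q_comb J \<le> real (card (verts J)) ^ 4 / 2 *
      (p ^ 3 - p ^ 4 - (2 * p\<^sup>2 - p - 1 / 8) * s - s\<^sup>2 - 2 * M - T)"
  have "(1 / 8 + p - 2 * p\<^sup>2) * s \<le> max 0 (1 / 8 + p - 2 * p\<^sup>2) * s"
    using * by (intro mult_right_mono) auto
  also have "\<dots> \<le> max 0 (1 / 8 + p - 2 * p\<^sup>2)"
    using * by (intro mult_left_le) auto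
  moreover have "(2 * p\<^sup>2 - p - 1 / 8) * s = - ((1 / 8 + p - 2 * p\<^sup>2) * s)"
    by (simp add: algebra_simps)
  ultimately have "p ^ 3 - p ^ 4 - (2 * p\<^sup>2 - p - 1 / 8) * s - s\<^sup>2 - 2 * M - T
      \<le> p ^ 3 - p ^ 4 + max 0 (1 / 8 + p - 2 * p\<^sup>2)"
    using * by (smt (verit) zero_le_power2)
  with le show ?thesis
    by (smt (verit) mult_left_mono divide_nonneg_nonneg zero_le_power of_nat_0_le_iff)
qed

text \<open>The maximum is at \<open>p = 3 / 4\<close>, so the difference has a double root there
  and the remaining quadratic factor is positive.\<close>

lemma cube_minus_fourth_le: "p ^ 3 - p ^ 4 \<le> (27 / 256 :: real)"
proof -
  have "27 / 256 - (p ^ 3 - p ^ 4) = (p - 3 / 4)\<^sup>2 * ((p + 1 / 4)\<^sup>2 + 1 / 8)"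
    by (simp add: power2_eq_square power3_eq_cube power4_eq_xxxx field_simps)
  moreover have "\<dots> \<ge> 0" by simp
  ultimately show ?thesis by linarith
qed

text \<open>The bound \<open>604 / 1000\<close> lies just above the threshold
  \<open>(1 + sqrt 2) / 4\<close>, and \<open>23 / 256\<close> is \<open>27 / 256 - 1 / 64\<close>:
  this leaves room for a gain of \<open>1 / 64\<close> from irregular degrees.\<close>

lemma cube_minus_fourth_le_small:
  fixes p :: real
  assumes "0 \<le> p" "p \<le> 604 / 1000"
  shows "p ^ 3 - p ^ 4 \<le> 23 / 256"
proof -
  \<comment> \<open>The factors \<open>p ^ 3\<close> and \<open>1 - p\<close> are bounded at
    opposite ends of an interval, which is sharp enough on the short intervals used near the upper
    end.\<close>
  have step: "p ^ 3 - p ^ 4 \<le> v ^ 3 * (1 - u)" if "u \<le> p" "p \<le> v" for u v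
  proof -
    have "p ^ 3 - p ^ 4 = p ^ 3 * (1 - p)" by (simp add: power3_eq_cube power4_eq_xxxx algebra_simps)
    also have "\<dots> \<le> v ^ 3 * (1 - u)"
      using that assms by (intro mult_mono power_mono) auto
    finally show ?thesis .
  qed
  consider "p \<le> 59 / 100" | "59 / 100 \<le> p" "p \<le> 6 / 10" | "6 / 10 \<le> p" by linarith
  then show ?thesis
  proof cases
    case 1
    have "p ^ 3 - p ^ 4 = p\<^sup>2 * (p * (1 - p))"
      by (simp add: power2_eq_square power3_eq_cube power4_eq_xxxx algebra_simps)
    also have "p * (1 - p) \<le> 1 / 4"
      using zero_le_power2[of "p - 1/2"] by (simp add: power2_eq_square algebra_simps)
    also have "p\<^sup>2 * (1 / 4) \<le> (59 / 100)\<^sup>2 * (1 / 4)"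
      using 1 assms by (intro mult_right_mono power_mono) auto
    finally show ?thesis by (simp add: mult_left_mono power2_eq_square)
  next
    case 2
    with step[of "59/100" "6/10"] show ?thesis by (simp add: power3_eq_cube)
  next
    case 3
    with step[of "6/10" "604/1000"] assms show ?thesis by (simp add: power3_eq_cube)
  qed
qed

text \<open>Valid at every density. Above \<open>604 / 1000\<close> variance does not help and the
  cubic bound suffices; below it the possible gain from \<open>s\<close> is offset by the smaller
  value of \<open>p ^ 3 - p ^ 4\<close>.\<close>

lemma comb_count_le_max:
  assumes J: "simple_graph J" "verts J \<noteq> {}"
  shows "comb_count Q_comb J \<le> real (card (verts J)) ^ 4 / 2 * (27 / 256)"
proof (rule comb_count_deficit[OF J])
  define p where "p = pair_density J"
  fix s M T :: real
  assume *: "0 \<le> s" "s \<le> 1" "0 \<le> M" "0 \<le> T"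
    and le: "comb_count Q_comb J \<le> real (card (verts J)) ^ 4 / 2 *
      ((pair_density J) ^ 3 - (pair_density J) ^ 4
        - (2 * (pair_density J)\<^sup>2 - pair_density J - 1 / 8) * s - s\<^sup>2 - 2 * M - T)"
  have "p ^ 3 - p ^ 4 - (2 * p\<^sup>2 - p - 1 / 8) * s - s\<^sup>2 - 2 * M - T \<le> 27 / 256"
  proof (cases "p \<le> 604 / 1000")
    case True
    \<comment> \<open>The coefficient of \<open>s\<close> in the gain is at most
      \<open>1 / 4\<close>, attained at \<open>p = 1 / 4\<close>, and \<open>s / 4 - s ^ 2\<close>
      is at most \<open>1 / 64\<close>, attained at \<open>s = 1 / 8\<close>.\<close>
    have "- ((2 * p\<^sup>2 - p - 1 / 8) * s) - s\<^sup>2 = 1 / 64 - (s - 1 / 8)\<^sup>2 - 2 * (p - 1 / 4)\<^sup>2 * s"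
      by (simp add: power2_eq_square field_simps)
    also have "\<dots> \<le> 1 / 64"
      using zero_le_power2[of "s - 1 / 8"] mult_nonneg_nonneg[OF zero_le_power2[of "p - 1 / 4"] *(1)]
      by linarith
    finally show ?thesis
      using cube_minus_fourth_le_small[OF pair_density_nonneg[of J, folded p_def] True] *
      by linarith
  next
    case False
    \<comment> \<open>Taylor expansion at \<open>604 / 1000\<close>: all three coefficients are
      positive.\<close>
    have "2 * p\<^sup>2 - p - 1 / 8 = 2 * (p - 604/1000)\<^sup>2 + (1416/1000) * (p - 604/1000) + 632 / 1000000"
      by (simp add: power2_eq_square field_simps)
    also have "\<dots> \<ge> 0" using False by (intro add_nonneg_nonneg) auto
    finally have "0 \<le> (2 * p\<^sup>2 - p - 1 / 8) * s" using * by simp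
    then show ?thesis
      using cube_minus_fourth_le[of p] * by (smt (verit) zero_le_power2)
  qed
  with le show ?thesis
    unfolding p_def
    by (smt (verit) mult_left_mono divide_nonneg_nonneg zero_le_power of_nat_0_le_iff)
qed

text \<open>Eight times the quadratic equals \<open>(4 * \<sigma> - 1) ^ 2 - 2\<close>.\<close>

lemma threshold_quadratic:
  fixes \<sigma> :: real
  assumes "(1 + sqrt 2) / 4 \<le> \<sigma>"
  shows "0 \<le> 2 * \<sigma>\<^sup>2 - \<sigma> - 1 / 8"
proof -
  have "(sqrt 2)\<^sup>2 \<le> (4 * \<sigma> - 1)\<^sup>2"
    using assms by (intro power_mono) auto
  then show ?thesis by (simp add: power2_eq_square algebra_simps)
qed

text \<open>A convergent upper bound \<open>U\<close> serves twice: it bounds the limit of an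
  arbitrary sequence, and it sandwiches the constructed sequence whose convergence is still to be
  shown.\<close>

lemma inducibility_at_upper:
  fixes J :: "nat \<Rightarrow> 'a ugraph"
  assumes \<sigma>: "(1 + sqrt 2) / 4 \<le> \<sigma>"
    and J: "\<And>n. simple_graph (J n)"
    and lim: "filterlim (\<lambda>n. card (verts (J n))) at_top sequentially"
    and dens: "(\<lambda>n. edge_density (J n)) \<longlonglongrightarrow> \<sigma>"
  obtains U where "eventually (\<lambda>n. comb_count Q_comb (J n) / real (card (verts (J n)) choose 4) \<le> U n) sequentially"
    and "U \<longlonglongrightarrow> 12 * \<sigma> ^ 3 * (1 - \<sigma>)"
proof
  define N where "N n = card (verts (J n))" for n
  define p where "p n = edge_density (J n) * (1 - 1 / real (N n))" for n
  define U where "U n = real (N n) ^ 4 / real (N n choose 4) *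
    ((p n) ^ 3 - (p n) ^ 4 + max 0 (1 / 8 + p n - 2 * (p n)\<^sup>2)) / 2" for n
  have inv: "(\<lambda>n. 1 / real (N n)) \<longlonglongrightarrow> 0"
    using filterlim_compose[OF lim_1_over_n lim] by (simp add: N_def)
  have ratio: "(\<lambda>n. real (N n) ^ 4 / real (N n choose 4)) \<longlonglongrightarrow> 24"
    using filterlim_compose[OF power4_over_choose_tendsto lim] by (simp add: N_def)
  have "p \<longlonglongrightarrow> \<sigma> * (1 - 0)"
    unfolding p_def by (intro tendsto_intros dens inv)
  then have p: "p \<longlonglongrightarrow> \<sigma>" by simp
  have "U \<longlonglongrightarrow> 24 * (\<sigma> ^ 3 - \<sigma> ^ 4 + max 0 (1 / 8 + \<sigma> - 2 * \<sigma>\<^sup>2)) / 2"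
    unfolding U_def by (intro tendsto_intros ratio p) auto
  also have "max 0 (1 / 8 + \<sigma> - 2 * \<sigma>\<^sup>2) = 0"
    using threshold_quadratic[OF \<sigma>] by simp
  also have "24 * (\<sigma> ^ 3 - \<sigma> ^ 4 + 0) / 2 = 12 * \<sigma> ^ 3 * (1 - \<sigma>)"
    by (simp add: power3_eq_cube power4_eq_xxxx field_simps)
  finally show "U \<longlonglongrightarrow> 12 * \<sigma> ^ 3 * (1 - \<sigma>)" .
  have "eventually (\<lambda>n. N n \<ge> 4) sequentially"
    using lim unfolding N_def filterlim_at_top by blast
  then show "eventually (\<lambda>n. comb_count Q_comb (J n) / real (card (verts (J n)) choose 4) \<le> U n) sequentially"
  proof eventually_elim
    case (elim n)
    have "verts (J n) \<noteq> {}" using elim by (auto simp: N_def)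
    from comb_count_le_density_bound[OF J this]
    have "comb_count Q_comb (J n) \<le> real (N n) ^ 4 / 2 *
        ((p n) ^ 3 - (p n) ^ 4 + max 0 (1 / 8 + p n - 2 * (p n)\<^sup>2))"
      using pair_density_eq[of "J n"] elim by (simp add: N_def p_def)
    then have "comb_count Q_comb (J n) / real (N n choose 4) \<le> real (N n) ^ 4 / 2 *
        ((p n) ^ 3 - (p n) ^ 4 + max 0 (1 / 8 + p n - 2 * (p n)\<^sup>2)) / real (N n choose 4)"
      by (rule divide_right_mono) simp
    then show ?case by (simp add: U_def N_def mult_ac)
  qed
qed

section \<open>Stability: near-extremal graphs are quasirandom\<close>

text \<open>Passes from mean square to mean absolute deviation through
  \<open>\<bar>u\<bar> \<le> u ^ 2 / (2 * \<tau>) + \<tau> / 2\<close>. The term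
  \<open>\<bar>P - S\<bar>\<close> pays for replacing the square of the pair density by that of the
  edge density.\<close>

lemma codegree_deviation_le:
  assumes J: "simple_graph J" "verts J \<noteq> {}" and \<tau>: "0 < \<tau>"
    and dev: "avg (verts J) (\<lambda>x. avg (verts J)
      (\<lambda>y. (real (card (nbhd J x \<inter> nbhd J y)) / real (card (verts J)) - P)\<^sup>2)) \<le> \<tau>\<^sup>2"
  shows "(\<Sum>x\<in>verts J. \<Sum>y\<in>verts J - {x}. \<bar>real (card (nbhd J x \<inter> nbhd J y)) - S * real (card (verts J))\<bar>)
    \<le> real (card (verts J)) ^ 3 * (\<tau> + \<bar>P - S\<bar>)"
proof -
  let ?V = "verts J"
  define n where "n = real (card ?V)"
  define c where "c x y = real (card (nbhd J x \<inter> nbhd J y)) / n" for x y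
  have fin: "finite ?V" using J by (simp add: simple_graph_def)
  have n0: "n > 0" using fin J by (simp add: n_def card_gt_0_iff)
  have amgm: "\<bar>u\<bar> \<le> u\<^sup>2 / (2 * \<tau>) + \<tau> / 2" for u
    using \<tau> zero_le_power2[of "\<bar>u\<bar> - \<tau>"] by (simp add: power2_diff field_simps power2_eq_square)
  have pt: "\<bar>real (card (nbhd J x \<inter> nbhd J y)) - S * n\<bar>
      \<le> n * ((c x y - P)\<^sup>2 / (2 * \<tau>) + (\<tau> / 2 + \<bar>P - S\<bar>))" for x y
  proof -
    have "real (card (nbhd J x \<inter> nbhd J y)) - S * n = n * (c x y - S)"
      using n0 by (simp add: c_def algebra_simps)
    then have "\<bar>real (card (nbhd J x \<inter> nbhd J y)) - S * n\<bar> = n * \<bar>c x y - S\<bar>"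
      using n0 by (simp add: abs_mult)
    also have "\<bar>c x y - S\<bar> \<le> (c x y - P)\<^sup>2 / (2 * \<tau>) + (\<tau> / 2 + \<bar>P - S\<bar>)"
      using amgm[of "c x y - P"] by linarith
    finally show ?thesis using n0 by (simp add: mult_left_mono)
  qed
  have "(\<Sum>x\<in>?V. \<Sum>y\<in>?V - {x}. \<bar>real (card (nbhd J x \<inter> nbhd J y)) - S * n\<bar>)
      \<le> (\<Sum>x\<in>?V. \<Sum>y\<in>?V. \<bar>real (card (nbhd J x \<inter> nbhd J y)) - S * n\<bar>)"
    using fin by (intro sum_mono sum_mono2) auto
  also have "\<dots> \<le> (\<Sum>x\<in>?V. \<Sum>y\<in>?V. n * ((c x y - P)\<^sup>2 / (2 * \<tau>) + (\<tau> / 2 + \<bar>P - S\<bar>)))"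
    by (intro sum_mono pt)
  also have "\<dots> = n\<^sup>2 * avg ?V (\<lambda>x. avg ?V (\<lambda>y. n * ((c x y - P)\<^sup>2 / (2 * \<tau>) + (\<tau> / 2 + \<bar>P - S\<bar>))))"
    using n0 by (simp add: avg_def n_def[symmetric] sum_divide_distrib[symmetric] power2_eq_square)
  also have "\<dots> = n ^ 3 * (avg ?V (\<lambda>x. avg ?V (\<lambda>y. (c x y - P)\<^sup>2)) / (2 * \<tau>) + (\<tau> / 2 + \<bar>P - S\<bar>))"
    by (simp only: avg_cmult avg_add avg_divide avg_const[OF fin J(2)]) (simp add: power2_eq_square power3_eq_cube)
  also have "\<dots> \<le> n ^ 3 * (\<tau>\<^sup>2 / (2 * \<tau>) + (\<tau> / 2 + \<bar>P - S\<bar>))"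
    using n0 \<tau> dev unfolding n_def[symmetric] c_def
    by (intro mult_left_mono add_right_mono divide_right_mono) auto
  also have "\<tau>\<^sup>2 / (2 * \<tau>) = \<tau> / 2" using \<tau> by (simp add: power2_eq_square)
  finally show ?thesis by (simp add: n_def)
qed

text \<open>At or above the threshold the coefficient of \<open>s\<close> is nonnegative up to
  \<open>O(1 / n)\<close>, so near-optimality gives \<open>s ^ 2 + 2 * M + T < \<delta>\<close> for
  large \<open>n\<close>. Hence \<open>s\<close> is at most \<open>sqrt \<delta>\<close>, the mean
  square codegree deviation at most \<open>sqrt \<delta>\<close>, and the mean absolute deviation of
  order \<open>\<delta> powr (1 / 4)\<close>, which is below the claimed power.\<close>

lemma quasirandom_of_near_extremal:
  fixes \<sigma> \<delta> :: real
  assumes \<sigma>: "(1 + sqrt 2) / 4 \<le> \<sigma>" "\<sigma> \<le> 1" and \<delta>: "0 < \<delta>" "\<delta> < 1 / 10 ^ 6"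
  shows "\<exists>n0. \<forall>n\<ge>n0. \<forall>J :: 'a ugraph. simple_graph J \<and> card (verts J) = n \<and>
    real (card (edges J)) = \<sigma> * real (n choose 2) \<and>
    comb_count Q_comb J > (12 * \<sigma> ^ 3 * (1 - \<sigma>) - \<delta>) * real (n choose 4) \<longrightarrow>
    quasirandom (3 * \<delta> powr (1 / 8)) J \<and> edge_density J = \<sigma>"
proof -
  define r where "r = 12 * \<sigma> ^ 3 * (1 - \<sigma>) - \<delta>"
  define p where "p n = \<sigma> * (1 - 1 / real n)" for n
  \<comment> \<open>The available deficit, with \<open>4 / n\<close> added for the possibly negative
    coefficient of \<open>s\<close>. It tends to \<open>\<delta> / 12\<close>, hence is eventually
    below \<open>\<delta>\<close>.\<close>
  define \<psi> where "\<psi> n = (p n) ^ 3 - (p n) ^ 4 + 4 * (1 / real n) - 2 * r / (real n ^ 4 / real (n choose 4))" for n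
  \<comment> \<open>The linear term \<open>s / 4\<close> dominates the codegree deviation and is
    only known to be of order \<open>sqrt \<delta>\<close>, so \<open>\<tau>\<close> is chosen with
    \<open>\<tau> ^ 2 = sqrt \<delta>\<close>.\<close>
  define \<tau> where "\<tau> = \<delta> powr (1 / 4)"
  have \<sigma>0: "0 \<le> \<sigma>" using \<sigma>(1) by (smt (verit) divide_nonneg_nonneg real_sqrt_ge_zero)
  have \<tau>0: "0 < \<tau>" using \<delta> by (simp add: \<tau>_def)
  have \<tau>2: "\<tau>\<^sup>2 = sqrt \<delta>"
    using \<delta> by (simp add: \<tau>_def power2_eq_square powr_add[symmetric] powr_half_sqrt)
  have \<tau>8: "\<tau> \<le> \<delta> powr (1 / 8)"
    unfolding \<tau>_def using \<delta> by (intro powr_mono') auto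
  have "p \<longlonglongrightarrow> \<sigma> * (1 - 0)" unfolding p_def by (intro tendsto_intros lim_1_over_n)
  then have p: "p \<longlonglongrightarrow> \<sigma>" by simp
  have "\<psi> \<longlonglongrightarrow> \<sigma> ^ 3 - \<sigma> ^ 4 + 4 * 0 - 2 * r / 24"
    unfolding \<psi>_def by (intro tendsto_intros p lim_1_over_n power4_over_choose_tendsto) auto
  also have "\<sigma> ^ 3 - \<sigma> ^ 4 + 4 * 0 - 2 * r / 24 = \<delta> / 12"
    by (simp add: r_def power3_eq_cube power4_eq_xxxx field_simps)
  finally have "eventually (\<lambda>n. \<psi> n < \<delta>) sequentially"
    by (rule order_tendstoD(2)) (use \<delta> in simp)
  moreover have "eventually (\<lambda>n. 2 * (1 / real n) < \<tau>) sequentially"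
    using order_tendstoD(2)[OF tendsto_mult[OF tendsto_const[of "2::real"] lim_1_over_n]] \<tau>0 by simp
  ultimately have "eventually (\<lambda>n. n \<ge> 4 \<and> \<psi> n < \<delta> \<and> 2 * (1 / real n) < \<tau>) sequentially"
    using eventually_ge_at_top[of 4] by eventually_elim simp
  then obtain n0 where n0: "\<And>n. n \<ge> n0 \<Longrightarrow> n \<ge> 4 \<and> \<psi> n < \<delta> \<and> 2 * (1 / real n) < \<tau>"
    unfolding eventually_sequentially by blast
  show ?thesis
  proof (intro exI[of _ n0] allI impI, elim conjE, fold r_def)
    fix n :: nat and J :: "'a ugraph"
    assume "n \<ge> n0" and J: "simple_graph J" and card: "card (verts J) = n"
      and E: "real (card (edges J)) = \<sigma> * real (n choose 2)"
      and many: "comb_count Q_comb J > r * real (n choose 4)"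
    have n: "n \<ge> 4" "\<psi> n < \<delta>" "2 * (1 / real n) < \<tau>" using n0 \<open>n \<ge> n0\<close> by blast+
    have ne: "verts J \<noteq> {}" using card n by auto
    have "n choose 2 \<noteq> 0" using n by simp
    then have dens: "edge_density J = \<sigma>" by (simp add: edge_density_def card E)
    have pd: "pair_density J = p n"
      using pair_density_eq[of J] n by (simp add: card dens p_def)
    define \<epsilon> where "\<epsilon> = 1 / real n"
    have \<epsilon>: "0 < \<epsilon>" "\<epsilon> \<le> 1" using n by (auto simp: \<epsilon>_def)
    \<comment> \<open>The pair density \<open>p n\<close> is smaller than \<open>\<sigma>\<close> by
      a factor \<open>1 - \<epsilon>\<close>, which can lower the coefficient below zero, but by at
      most \<open>4 * \<epsilon>\<close>.\<close>
    have b: "- 4 * \<epsilon> \<le> 2 * (p n)\<^sup>2 - p n - 1 / 8"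
    proof -
      have "2 * (p n)\<^sup>2 - p n - 1 / 8
          = (2 * \<sigma>\<^sup>2 - \<sigma> - 1 / 8) + (2 * \<sigma>\<^sup>2 * \<epsilon>\<^sup>2 + \<sigma> * \<epsilon>) - 4 * (\<sigma>\<^sup>2 * \<epsilon>)"
        by (simp add: p_def \<epsilon>_def[symmetric] power2_eq_square algebra_simps)
      moreover have "0 \<le> 2 * \<sigma>\<^sup>2 * \<epsilon>\<^sup>2 + \<sigma> * \<epsilon>" using \<sigma>0 \<epsilon> by simp
      moreover have "\<sigma>\<^sup>2 * \<epsilon> \<le> 1 * \<epsilon>" using \<sigma>0 \<sigma> \<epsilon> by (intro mult_right_mono power_le_one) auto
      ultimately show ?thesis using threshold_quadratic[OF \<sigma>(1)] by linarith
    qed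
    have psq: "\<bar>(p n)\<^sup>2 - \<sigma>\<^sup>2\<bar> \<le> 2 * \<epsilon>"
    proof -
      have "(p n)\<^sup>2 - \<sigma>\<^sup>2 = - (\<sigma>\<^sup>2 * (\<epsilon> * (2 - \<epsilon>)))"
        by (simp add: p_def \<epsilon>_def[symmetric] power2_eq_square algebra_simps)
      then have "\<bar>(p n)\<^sup>2 - \<sigma>\<^sup>2\<bar> = \<sigma>\<^sup>2 * (\<epsilon> * (2 - \<epsilon>))" using \<epsilon> by (simp add: abs_mult)
      also have "\<dots> \<le> 1 * (\<epsilon> * 2)"
        using \<sigma>0 \<sigma> \<epsilon> by (intro mult_mono mult_left_mono power_le_one) auto
      finally show ?thesis by simp
    qed
    obtain s M T :: real where *: "0 \<le> s" "s \<le> 1" "0 \<le> M" "0 \<le> T"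
      and le: "comb_count Q_comb J \<le> real n ^ 4 / 2 *
        ((p n) ^ 3 - (p n) ^ 4 - (2 * (p n)\<^sup>2 - p n - 1 / 8) * s - s\<^sup>2 - 2 * M - T)"
      and dev: "avg (verts J) (\<lambda>x. avg (verts J)
        (\<lambda>y. (real (card (nbhd J x \<inter> nbhd J y)) / real n - (p n)\<^sup>2)\<^sup>2)) \<le> s\<^sup>2 + s / 4 + 4 * M + T"
      using comb_count_deficit[OF J ne, unfolded pd card] by blast
    have "- 4 * \<epsilon> \<le> (2 * (p n)\<^sup>2 - p n - 1 / 8) * s"
      using mult_right_mono[OF b *(1)] mult_left_le[of s \<epsilon>] * \<epsilon> by linarith
    moreover have "2 * r / (real n ^ 4 / real (n choose 4))
        < (p n) ^ 3 - (p n) ^ 4 - (2 * (p n)\<^sup>2 - p n - 1 / 8) * s - s\<^sup>2 - 2 * M - T"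
    proof -
      have "r * real (n choose 4) < real n ^ 4 / 2 *
        ((p n) ^ 3 - (p n) ^ 4 - (2 * (p n)\<^sup>2 - p n - 1 / 8) * s - s\<^sup>2 - 2 * M - T)"
        using many le by linarith
      then show ?thesis using n by (simp add: divide_less_eq mult_ac)
    qed
    ultimately have sum: "s\<^sup>2 + 2 * M + T < \<delta>"
      using n(2) unfolding \<psi>_def \<epsilon>_def by linarith
    then have "s\<^sup>2 \<le> \<delta>" using * by linarith
    then have "s \<le> sqrt \<delta>" by (simp add: real_le_rsqrt)
    \<comment> \<open>Here the upper bound on \<open>\<delta>\<close> enters:
      \<open>s ^ 2 + 4 * M + T\<close> is below \<open>2 * \<delta>\<close>, a small fraction of
      \<open>sqrt \<delta>\<close>, so adding \<open>s / 4\<close> stays below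
      \<open>sqrt \<delta>\<close>.\<close>
    moreover have "\<delta> \<le> sqrt \<delta> / 1000"
    proof -
      have "sqrt \<delta> \<le> sqrt ((1 / 1000)\<^sup>2)"
        using \<delta> by (intro real_sqrt_le_mono) (simp add: power2_eq_square)
      then have "sqrt \<delta> \<le> 1 / 1000" by simp
      then have "sqrt \<delta> * sqrt \<delta> \<le> sqrt \<delta> * (1 / 1000)" using \<delta> by (intro mult_left_mono) auto
      then show ?thesis using \<delta> by simp
    qed
    moreover have "0 \<le> s\<^sup>2" "0 < sqrt \<delta>" using \<delta> by simp_all
    ultimately have "s\<^sup>2 + s / 4 + 4 * M + T \<le> \<tau>\<^sup>2"
      unfolding \<tau>2 using sum * by linarith
    with dev have "avg (verts J) (\<lambda>x. avg (verts J)
        (\<lambda>y. (real (card (nbhd J x \<inter> nbhd J y)) / real (card (verts J)) - (p n)\<^sup>2)\<^sup>2)) \<le> \<tau>\<^sup>2"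
      by (simp add: card)
    from codegree_deviation_le[OF J ne \<tau>0 this, of "\<sigma>\<^sup>2"]
    have "(\<Sum>x\<in>verts J. \<Sum>y\<in>verts J - {x}. \<bar>real (card (nbhd J x \<inter> nbhd J y)) - \<sigma>\<^sup>2 * real n\<bar>)
      \<le> real n ^ 3 * (\<tau> + \<bar>(p n)\<^sup>2 - \<sigma>\<^sup>2\<bar>)" by (simp add: card)
    also have "\<dots> < real n ^ 3 * (3 * \<delta> powr (1 / 8))"
    proof (rule mult_strict_left_mono)
      show "\<tau> + \<bar>(p n)\<^sup>2 - \<sigma>\<^sup>2\<bar> < 3 * \<delta> powr (1 / 8)"
        using psq n(3) \<tau>8 \<tau>0 unfolding \<epsilon>_def by linarith
    qed (use n in simp)
    finally have "quasirandom (3 * \<delta> powr (1 / 8)) J"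
      unfolding quasirandom_def dens card by (simp add: mult_ac)
    with dens show "quasirandom (3 * \<delta> powr (1 / 8)) J \<and> edge_density J = \<sigma>" by simp
  qed
qed

section \<open>Random graphs\<close>

text \<open>The indicator of a pattern is a product of one-coordinate factors, equal to 1 off
  \<open>S\<close> and \<open>T\<close>, so independence makes its expectation a product.\<close>

lemma expectation_edge_pattern:
  assumes "finite A" "S \<subseteq> A" "T \<subseteq> A" "S \<inter> T = {}" "0 \<le> \<sigma>" "\<sigma> \<le> 1"
  shows "measure_pmf.expectation (Pi_pmf A False (\<lambda>_. bernoulli_pmf \<sigma>))
      (\<lambda>X. of_bool ((\<forall>e\<in>S. X e) \<and> (\<forall>e\<in>T. \<not> X e))) = \<sigma> ^ card S * (1 - \<sigma>) ^ card T"
proof -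
  define f :: "'a \<Rightarrow> bool \<Rightarrow> real" where
    "f e v = (if e \<in> S then of_bool v else if e \<in> T then of_bool (\<not> v) else 1)" for e v
  have f01: "f e v = of_bool ((e \<in> S \<longrightarrow> v) \<and> (e \<in> T \<longrightarrow> \<not> v))" for e v
    using assms(4) by (auto simp: f_def)
  have prod: "(\<Prod>e\<in>A. f e (X e)) = of_bool ((\<forall>e\<in>S. X e) \<and> (\<forall>e\<in>T. \<not> X e))" for X
  proof -
    have "(\<Prod>e\<in>A. f e (X e)) = of_bool (\<forall>e\<in>A. (e \<in> S \<longrightarrow> X e) \<and> (e \<in> T \<longrightarrow> \<not> X e))"
      unfolding f01 using assms(1) by (induction A rule: finite_induct) auto
    moreover have "(\<forall>e\<in>A. (e \<in> S \<longrightarrow> X e) \<and> (e \<in> T \<longrightarrow> \<not> X e)) \<longleftrightarrow> (\<forall>e\<in>S. X e) \<and> (\<forall>e\<in>T. \<not> X e)"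
      using assms(2,3) by blast
    ultimately show ?thesis by simp
  qed
  have "measure_pmf.expectation (Pi_pmf A False (\<lambda>_. bernoulli_pmf \<sigma>)) (\<lambda>X. \<Prod>e\<in>A. f e (X e))
      = (\<Prod>e\<in>A. measure_pmf.expectation (bernoulli_pmf \<sigma>) (f e))"
    by (rule expectation_prod_Pi_pmf[OF assms(1)])
       (auto intro!: integrable_measure_pmf_finite simp: f01)
  also have "\<dots> = (\<Prod>e\<in>A. (if e \<in> S then \<sigma> else 1) * (if e \<in> T then 1 - \<sigma> else 1))"
    using assms(4-6) by (intro prod.cong) (auto simp: f01)
  also have "\<dots> = \<sigma> ^ card S * (1 - \<sigma>) ^ card T"
  proof -
    have "A \<inter> S = S" "A \<inter> T = T" using assms by auto
    then show ?thesis
      using assms(1) by (simp add: prod.distrib prod.If_cases)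
  qed
  finally show ?thesis by (simp add: prod)
qed

lemma finite_all_pairs: "finite V \<Longrightarrow> finite (all_pairs V)"
  by (rule finite_subset[of _ "Pow V"]) (auto simp: all_pairs_def)

lemma card_all_pairs: "finite V \<Longrightarrow> card (all_pairs V) = card V choose 2"
  unfolding all_pairs_def by (rule n_subsets)

lemma card_quads:
  assumes "finite V" "card V \<ge> 4"
  shows "real (card (quads V)) = 24 * real (card V choose 4)"
proof -
  define n where "n = card V"
  have "real (card (quads V)) = (\<Sum>t\<in>quads V. 1)" by simp
  also have "\<dots> = (\<Sum>w\<in>V. \<Sum>x\<in>V - {w}. \<Sum>y\<in>V - {w, x}. \<Sum>z\<in>V - {w, x, y}. 1)"
    by (rule sum_quads[OF assms(1)])
  also have "\<dots> = (\<Sum>w\<in>V. \<Sum>x\<in>V - {w}. \<Sum>y\<in>V - {w, x}. real (n - 3))"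
    using assms by (intro sum.cong refl) (auto simp: n_def card_Diff_subset card_insert_if)
  also have "\<dots> = (\<Sum>w\<in>V. \<Sum>x\<in>V - {w}. real (n - 2) * real (n - 3))"
    using assms by (intro sum.cong refl) (auto simp: n_def card_Diff_subset card_insert_if)
  also have "\<dots> = real n * (real (n - 1) * (real (n - 2) * real (n - 3)))"
    using assms by (simp add: n_def card_Diff_subset)
  also have "\<dots> = 24 * real (n choose 4)"
    using assms unfolding n_def[symmetric]
    by (simp add: binomial_gbinomial gbinomial_prod_rev numeral_eq_Suc fact_numeral algebra_simps of_nat_diff)
  finally show ?thesis by (simp add: n_def)
qed

text \<open>The trivial bound, with every quadruple open. It controls the density penalty in the
  random construction and confines the counts to a bounded range.\<close>

lemma comb_count_le_12_choose:
  assumes "simple_graph J" "card (verts J) \<ge> 4"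
  shows "comb_count Q_comb J \<le> 12 * real (card (verts J) choose 4)"
proof -
  have fin: "finite (verts J)" using assms by (simp add: simple_graph_def)
  have "(\<Sum>t\<in>quads (verts J). of_bool (open_path J t)) \<le> (\<Sum>t\<in>quads (verts J). 1::real)"
    by (intro sum_mono) simp
  then show ?thesis
    unfolding comb_count_eq_open_path_count[OF assms(1)] using card_quads[OF fin assms(2)] by simp
qed

lemma simple_graph_random: "simple_graph ({..<n::nat}, {e \<in> all_pairs {..<n}. X e})"
  by (auto simp: simple_graph_def)

lemma integrable_binomial_random_graph:
  fixes f :: "nat ugraph \<Rightarrow> real"
  shows "integrable (measure_pmf (binomial_random_graph n \<sigma>)) f"
proof (rule integrable_measure_pmf_finite)
  show "finite (set_pmf (binomial_random_graph n \<sigma>))"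
    by (rule finite_subset[of _ "{{..<n}} \<times> Pow (all_pairs {..<n})"])
       (auto simp: binomial_random_graph_def finite_all_pairs)
qed

text \<open>A quadruple of distinct vertices involves four distinct pairs, so it is open with
  probability \<open>\<sigma> ^ 3 * (1 - \<sigma>)\<close>. Linearity gives an exact value for each
  \<open>n\<close>, with no limit involved.\<close>

lemma expectation_random_comb_count:
  assumes \<sigma>: "0 \<le> \<sigma>" "\<sigma> \<le> 1" and n: "n \<ge> 4"
  shows "measure_pmf.expectation (binomial_random_graph n \<sigma>) (comb_count Q_comb)
    = 12 * \<sigma> ^ 3 * (1 - \<sigma>) * real (n choose 4)"
proof -
  let ?A = "all_pairs {..<n}"
  let ?M = "Pi_pmf ?A False (\<lambda>_. bernoulli_pmf \<sigma>)"
  define G where "G X = ({..<n}, {e \<in> ?A. X e})" for X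
  have finA: "finite ?A" by (simp add: finite_all_pairs)
  have prob: "measure_pmf.expectation ?M (\<lambda>X. of_bool (open_path (G X) t)) = \<sigma> ^ 3 * (1 - \<sigma>)"
    if t: "t \<in> quads {..<n}" for t
  proof (cases t)
    case (fields w x y z)
    have d: "w < n" "x < n" "y < n" "z < n" "w \<noteq> x" "w \<noteq> y" "w \<noteq> z" "x \<noteq> y" "x \<noteq> z" "y \<noteq> z"
      using t by (auto simp: fields quads_def)
    let ?S = "{{w, x}, {x, y}, {y, z}}" and ?T = "{{z, w}}"
    have sub: "?S \<subseteq> ?A" "?T \<subseteq> ?A" using d by (auto simp: all_pairs_def)
    have "open_path (G X) t \<longleftrightarrow> (\<forall>e\<in>?S. X e) \<and> (\<forall>e\<in>?T. \<not> X e)" for X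
      using sub by (auto simp: fields open_path_def G_def)
    moreover have "?S \<inter> ?T = {}" "card ?S = 3" using d by (auto simp: doubleton_eq_iff card_insert_if)
    ultimately show ?thesis
      using expectation_edge_pattern[OF finA sub _ \<sigma>] by simp
  qed
  have "measure_pmf.expectation (binomial_random_graph n \<sigma>) (comb_count Q_comb)
      = measure_pmf.expectation ?M (\<lambda>X. comb_count Q_comb (G X))"
    by (simp add: binomial_random_graph_def G_def)
  also have "\<dots> = measure_pmf.expectation ?M (\<lambda>X. (\<Sum>t\<in>quads {..<n}. of_bool (open_path (G X) t)) / 2)"
    by (simp add: comb_count_eq_open_path_count simple_graph_random G_def)
  also have "\<dots> = (\<Sum>t\<in>quads {..<n}. measure_pmf.expectation ?M (\<lambda>X. of_bool (open_path (G X) t))) / 2"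
    by (subst integral_divide_zero, subst Bochner_Integration.integral_sum)
       (auto intro!: measure_pmf.integrable_const_bound[where B = 1])
  also have "\<dots> = 12 * \<sigma> ^ 3 * (1 - \<sigma>) * real (n choose 4)"
    using n by (simp add: prob card_quads)
  finally show ?thesis .
qed

lemma rand_density_Q_comb:
  assumes "0 \<le> \<sigma>" "\<sigma> \<le> 1"
  shows "rand_density 4 Q_comb \<sigma> = 12 * \<sigma> ^ 3 * (1 - \<sigma>)"
  unfolding rand_density_def
proof (rule limI, rule tendsto_eventually)
  show "eventually (\<lambda>n. measure_pmf.expectation (binomial_random_graph n \<sigma>) (comb_count Q_comb)
      / real (n choose 4) = 12 * \<sigma> ^ 3 * (1 - \<sigma>)) sequentially"
    using eventually_ge_at_top[of 4]
    by eventually_elim (simp add: expectation_random_comb_count assms)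
qed

text \<open>The variance of a binomial edge count, obtained by expanding the square over ordered
  pairs \<open>(e, f)\<close>: only the diagonal \<open>e = f\<close> deviates from independence, by
  \<open>\<sigma> - \<sigma> ^ 2\<close>.\<close>

lemma expectation_random_edge_density_variance:
  assumes \<sigma>: "0 \<le> \<sigma>" "\<sigma> \<le> 1" and n: "n \<ge> 2"
  shows "measure_pmf.expectation (binomial_random_graph n \<sigma>) (\<lambda>J. (edge_density J - \<sigma>)\<^sup>2)
    = \<sigma> * (1 - \<sigma>) / real (n choose 2)"
proof -
  let ?A = "all_pairs {..<n}"
  let ?M = "Pi_pmf ?A False (\<lambda>_. bernoulli_pmf \<sigma>)"
  define N where "N = real (n choose 2)"
  have finA: "finite ?A" by (simp add: finite_all_pairs)
  have N: "real (card ?A) = N" by (simp add: N_def card_all_pairs)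
  have N0: "N > 0" using n by (simp add: N_def)
  have int: "integrable (measure_pmf ?M) (\<lambda>X. of_bool (P X) :: real)" for P
    by (auto intro!: measure_pmf.integrable_const_bound[where B = 1])
  have one: "measure_pmf.expectation ?M (\<lambda>X. of_bool (X e)) = \<sigma>" if "e \<in> ?A" for e
    using expectation_edge_pattern[OF finA, of "{e}" "{}", OF _ _ _ \<sigma>] that by simp
  have two: "measure_pmf.expectation ?M (\<lambda>X. of_bool (X e \<and> X f)) = (if e = f then \<sigma> else \<sigma>\<^sup>2)"
    if "e \<in> ?A" "f \<in> ?A" for e f
    using expectation_edge_pattern[OF finA, of "{e, f}" "{}", OF _ _ _ \<sigma>] that
    by (cases "e = f") (simp_all add: power2_eq_square)
  have dens: "(edge_density ({..<n}, {e \<in> ?A. X e}) - \<sigma>)\<^sup>2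
      = ((\<Sum>e\<in>?A. \<Sum>f\<in>?A. of_bool (X e \<and> X f)) - 2 * \<sigma> * N * (\<Sum>e\<in>?A. of_bool (X e)) + (\<sigma> * N)\<^sup>2) / N\<^sup>2" for X
  proof -
    have "real (card {e \<in> ?A. X e}) = (\<Sum>e\<in>?A. of_bool (X e))"
      using finA by (simp add: Int_def)
    then have "edge_density ({..<n}, {e \<in> ?A. X e}) - \<sigma> = ((\<Sum>e\<in>?A. of_bool (X e)) - \<sigma> * N) / N"
      using N0 by (simp add: edge_density_def N_def field_simps)
    moreover have "(\<Sum>e\<in>?A. \<Sum>f\<in>?A. of_bool (X e \<and> X f)) = (\<Sum>e\<in>?A. of_bool (X e) :: real)\<^sup>2"
      by (simp only: of_bool_conj power2_eq_square sum_product)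
    ultimately show ?thesis by (simp only: power_divide power2_diff) (simp add: algebra_simps)
  qed
  have "measure_pmf.expectation (binomial_random_graph n \<sigma>) (\<lambda>J. (edge_density J - \<sigma>)\<^sup>2)
      = measure_pmf.expectation ?M (\<lambda>X. ((\<Sum>e\<in>?A. \<Sum>f\<in>?A. of_bool (X e \<and> X f))
          - 2 * \<sigma> * N * (\<Sum>e\<in>?A. of_bool (X e)) + (\<sigma> * N)\<^sup>2) / N\<^sup>2)"
    by (simp only: binomial_random_graph_def integral_map_pmf dens)
  also have "\<dots> = ((\<Sum>e\<in>?A. \<Sum>f\<in>?A. measure_pmf.expectation ?M (\<lambda>X. of_bool (X e \<and> X f)))
          - 2 * \<sigma> * N * (\<Sum>e\<in>?A. measure_pmf.expectation ?M (\<lambda>X. of_bool (X e))) + (\<sigma> * N)\<^sup>2) / N\<^sup>2"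
    by (simp only: integral_divide_zero integral_mult_right_zero Bochner_Integration.integral_add
        Bochner_Integration.integral_diff Bochner_Integration.integral_sum int
        Bochner_Integration.integrable_sum Bochner_Integration.integrable_diff
        integrable_mult_right measure_pmf.integrable_const lebesgue_integral_const
        measure_pmf.prob_space) simp
  also have "(\<Sum>e\<in>?A. \<Sum>f\<in>?A. measure_pmf.expectation ?M (\<lambda>X. of_bool (X e \<and> X f)))
      = (\<Sum>e\<in>?A. \<Sum>f\<in>?A. \<sigma>\<^sup>2 + (if e = f then \<sigma> - \<sigma>\<^sup>2 else 0))"
    by (intro sum.cong refl) (auto simp: two)
  also have "\<dots> = N * (N * \<sigma>\<^sup>2 + (\<sigma> - \<sigma>\<^sup>2))"
    using finA by (simp add: sum.distrib N)
  also have "(\<Sum>e\<in>?A. measure_pmf.expectation ?M (\<lambda>X. of_bool (X e))) = N * \<sigma>"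
    by (simp add: one N)
  also have "(N * (N * \<sigma>\<^sup>2 + (\<sigma> - \<sigma>\<^sup>2)) - 2 * \<sigma> * N * (N * \<sigma>) + (\<sigma> * N)\<^sup>2) / N\<^sup>2 = \<sigma> * (1 - \<sigma>) / N"
    using N0 by (simp add: field_simps power2_eq_square)
  finally show ?thesis by (simp add: N_def)
qed

text \<open>The penalty term makes a single first-moment argument control the count and the density at once.\<close>

lemma exists_graph_near_random:
  assumes \<sigma>: "0 \<le> \<sigma>" "\<sigma> \<le> 1" and n: "n \<ge> 4" and K: "0 \<le> K"
  shows "\<exists>J :: nat ugraph. simple_graph J \<and> card (verts J) = n \<and>
    12 * \<sigma> ^ 3 * (1 - \<sigma>) - K / real (n choose 2)
      \<le> comb_count Q_comb J / real (n choose 4) - K * (edge_density J - \<sigma>)\<^sup>2"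
proof (rule ccontr)
  let ?G = "binomial_random_graph n \<sigma>"
  let ?f = "\<lambda>J. comb_count Q_comb J / real (n choose 4) - K * (edge_density J - \<sigma>)\<^sup>2"
  let ?r = "12 * \<sigma> ^ 3 * (1 - \<sigma>) - K / real (n choose 2)"
  assume "\<not> ?thesis"
  then have less: "?f J < ?r" if "simple_graph J" "card (verts J) = n" for J :: "nat ugraph"
    using that not_le by blast
  have "measure_pmf.expectation ?G ?f
      = 12 * \<sigma> ^ 3 * (1 - \<sigma>) - K * (\<sigma> * (1 - \<sigma>) / real (n choose 2))"
    using n by (simp add: integrable_binomial_random_graph expectation_random_comb_count
        expectation_random_edge_density_variance \<sigma>)
  moreover have "K * (\<sigma> * (1 - \<sigma>) / real (n choose 2)) \<le> K / real (n choose 2)"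
  proof -
    have "\<sigma> * (1 - \<sigma>) \<le> 1" using \<sigma> by (intro mult_le_one) auto
    then have "K * (\<sigma> * (1 - \<sigma>)) / real (n choose 2) \<le> K * 1 / real (n choose 2)"
      using K by (intro divide_right_mono mult_left_mono) auto
    then show ?thesis by simp
  qed
  moreover have "measure_pmf.expectation ?G ?f < ?r"
  proof (rule measure_pmf.expectation_less)
    show "AE J in ?G. ?f J < ?r"
      by (rule AE_pmfI) (auto simp: binomial_random_graph_def intro!: less simple_graph_random)
  qed (simp_all add: integrable_binomial_random_graph)
  ultimately show False by linarith
qed

section \<open>Inducibility\<close>

text \<open>The supremum is attained by a sequence of graphs that are good both in count and in
  density; the upper bound applies to this sequence as well and so forces convergence.\<close>

lemma inducibility_at_Q_comb:
  assumes \<sigma>: "(1 + sqrt 2) / 4 \<le> \<sigma>" "\<sigma> \<le> 1"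
  shows "inducibility_at 4 Q_comb \<sigma> = 12 * \<sigma> ^ 3 * (1 - \<sigma>)"
  unfolding inducibility_at_def
proof (rule cSup_eq_maximum, goal_cases)
  case 1
  define r where "r = 12 * \<sigma> ^ 3 * (1 - \<sigma>)"
  have \<sigma>0: "0 \<le> \<sigma>" using \<sigma>(1) by (smt (verit) divide_nonneg_nonneg real_sqrt_ge_zero)
  have r0: "0 \<le> r" using \<sigma>0 \<sigma> by (simp add: r_def)
  \<comment> \<open>The penalty weight \<open>n + 4\<close> grows, which forces the densities to
    converge, yet its quotient by \<open>n + 4 choose 2\<close> is \<open>2 / (n + 3)\<close> and
    vanishes. The shift by 4 guarantees enough vertices for every index.\<close>
  have "\<exists>J :: nat \<Rightarrow> nat ugraph. \<forall>n. simple_graph (J n) \<and> card (verts (J n)) = n + 4 \<and>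
    r - real (n + 4) / real (n + 4 choose 2)
      \<le> comb_count Q_comb (J n) / real (n + 4 choose 4) - real (n + 4) * (edge_density (J n) - \<sigma>)\<^sup>2"
    unfolding r_def by (intro choice allI exists_graph_near_random \<sigma>0 \<sigma>) auto
  then obtain J :: "nat \<Rightarrow> nat ugraph" where J: "\<And>n. simple_graph (J n)"
    and card: "\<And>n. card (verts (J n)) = n + 4"
    and near: "\<And>n. r - real (n + 4) / real (n + 4 choose 2)
      \<le> comb_count Q_comb (J n) / real (n + 4 choose 4) - real (n + 4) * (edge_density (J n) - \<sigma>)\<^sup>2"
    by blast
  have choose2: "real (n + 4) / real (n + 4 choose 2) = 2 / real (n + 3)" for n
  proof -
    have "real (n + 4 choose 2) = real (n + 4) * real (n + 3) / 2"
      by (simp add: choose_two real_of_nat_div)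
    then show ?thesis by (simp add: divide_simps)
  qed
  have inv: "(\<lambda>n. c / real (n + k)) \<longlonglongrightarrow> 0" for c k
    using LIMSEQ_ignore_initial_segment[OF lim_const_over_n[of c], of k] by simp
  have lim: "filterlim (\<lambda>n. card (verts (J n))) at_top sequentially"
    unfolding card by (rule filterlim_add_const_nat_at_top)
  \<comment> \<open>The 14 is the trivial bound 12 on the normalised count plus the error term,
    which is at most 2.\<close>
  have dev: "(edge_density (J n) - \<sigma>)\<^sup>2 \<le> 14 / real (n + 4)" for n
  proof -
    have "comb_count Q_comb (J n) / real (n + 4 choose 4) \<le> 12"
      using comb_count_le_12_choose[OF J, of n] by (simp add: card divide_le_eq)
    moreover have "real (n + 4) / real (n + 4 choose 2) \<le> 2"
      unfolding choose2 by (simp add: divide_le_eq)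
    ultimately have "real (n + 4) * (edge_density (J n) - \<sigma>)\<^sup>2 \<le> 14"
      using near[of n] r0 by linarith
    then show ?thesis by (simp add: le_divide_eq mult.commute)
  qed
  have "(\<lambda>n. (edge_density (J n) - \<sigma>)\<^sup>2) \<longlonglongrightarrow> 0"
    by (rule tendsto_sandwich[OF _ _ tendsto_const inv[of 14 4]]) (use dev in auto)
  then have "(\<lambda>n. sqrt ((edge_density (J n) - \<sigma>)\<^sup>2)) \<longlonglongrightarrow> sqrt 0"
    by (rule tendsto_real_sqrt)
  then have dens: "(\<lambda>n. edge_density (J n)) \<longlonglongrightarrow> \<sigma>"
    by (simp add: tendsto_rabs_zero_iff LIM_zero_iff)
  obtain U where U: "eventually (\<lambda>n. comb_count Q_comb (J n) / real (card (verts (J n)) choose 4) \<le> U n) sequentially"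
    "U \<longlonglongrightarrow> r"
    using inducibility_at_upper[of \<sigma> J, OF \<sigma>(1) J lim dens] unfolding r_def by blast
  have "(\<lambda>n. r - 2 / real (n + 3)) \<longlonglongrightarrow> r - 0"
    by (intro tendsto_intros inv)
  then have L: "(\<lambda>n. r - 2 / real (n + 3)) \<longlonglongrightarrow> r" by simp
  have "eventually (\<lambda>n. r - 2 / real (n + 3) \<le> comb_count Q_comb (J n) / real (card (verts (J n)) choose 4)) sequentially"
  proof (rule always_eventually, rule allI)
    fix n
    have "0 \<le> real (n + 4) * (edge_density (J n) - \<sigma>)\<^sup>2" by simp
    then show "r - 2 / real (n + 3) \<le> comb_count Q_comb (J n) / real (card (verts (J n)) choose 4)"
      using near[of n] unfolding choose2 card by linarith
  qed
  from tendsto_sandwich[OF this U(1) L U(2)]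
  show ?case using J lim dens unfolding r_def by blast
next
  case (2 y)
  then obtain J :: "nat \<Rightarrow> nat ugraph" where J: "\<And>n. simple_graph (J n)"
    and lim: "filterlim (\<lambda>n. card (verts (J n))) at_top sequentially"
    and dens: "(\<lambda>n. edge_density (J n)) \<longlonglongrightarrow> \<sigma>"
    and y: "(\<lambda>n. comb_count Q_comb (J n) / real (card (verts (J n)) choose 4)) \<longlonglongrightarrow> y"
    by blast
  obtain U where "eventually (\<lambda>n. comb_count Q_comb (J n) / real (card (verts (J n)) choose 4) \<le> U n) sequentially"
    "U \<longlonglongrightarrow> 12 * \<sigma> ^ 3 * (1 - \<sigma>)"
    using inducibility_at_upper[of \<sigma> J, OF \<sigma>(1) J lim dens] by blast
  with y show ?case by (intro tendsto_le[OF sequentially_bot]) auto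
qed

section \<open>The maximum over all densities\<close>

text \<open>There are infinitely many graphs with \<open>n\<close> vertices in \<open>nat\<close>,
  but their counts are half-integers in a bounded range. This makes the \<open>Max\<close> in
  \<open>comb_max\<close> meaningful.\<close>

lemma finite_comb_counts:
  assumes "n \<ge> 4"
  shows "finite {comb_count Q_comb J | J :: nat ugraph. simple_graph J \<and> card (verts J) = n}"
proof (rule finite_subset)
  show "{comb_count Q_comb J | J :: nat ugraph. simple_graph J \<and> card (verts J) = n}
      \<subseteq> (\<lambda>k. real k / 2) ` {..24 * (n choose 4)}"
  proof (clarify)
    fix J :: "nat ugraph"
    assume J: "simple_graph J" and n: "n = card (verts J)"
    have fin: "finite (quads (verts J))" using J by (simp add: simple_graph_def finite_quads)
    have eq: "comb_count Q_comb J = real (card (quads (verts J) \<inter> Collect (open_path J))) / 2"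
      unfolding comb_count_eq_open_path_count[OF J] using fin by simp
    moreover have "comb_count Q_comb J \<le> 12 * real (n choose 4)"
      using comb_count_le_12_choose[OF J] assms n by simp
    ultimately have "real (card (quads (verts J) \<inter> Collect (open_path J))) \<le> real (24 * (n choose 4))"
      by simp
    then have "card (quads (verts J) \<inter> Collect (open_path J)) \<le> 24 * (n choose 4)"
      by (simp only: of_nat_le_iff)
    with eq show "comb_count Q_comb J \<in> (\<lambda>k. real k / 2) ` {..24 * (card (verts J) choose 4)}"
      unfolding n by blast
  qed
qed simp

lemma comb_max_density_tendsto:
  "(\<lambda>n. comb_max Q_comb n / real (n choose 4)) \<longlonglongrightarrow> 81 / 64"
proof (rule tendsto_sandwich)
  show "eventually (\<lambda>n. 81 / 64 \<le> comb_max Q_comb n / real (n choose 4)) sequentially"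
    using eventually_ge_at_top[of 4]
  proof eventually_elim
    case (elim n)
    \<comment> \<open>The density \<open>3 / 4\<close> maximises
      \<open>12 * \<sigma> ^ 3 * (1 - \<sigma>)\<close>, with value \<open>81 / 64\<close>; with
      penalty weight 0 this is the plain first-moment argument.\<close>
    obtain J :: "nat ugraph" where J: "simple_graph J" "card (verts J) = n"
      and many: "81 / 64 \<le> comb_count Q_comb J / real (n choose 4)"
      using exists_graph_near_random[of "3 / 4" n 0] elim by (auto simp: power3_eq_cube)
    have "comb_count Q_comb J \<le> comb_max Q_comb n"
      unfolding comb_max_def using J by (intro Max_ge finite_comb_counts[OF elim]) blast
    then have "comb_count Q_comb J / real (n choose 4) \<le> comb_max Q_comb n / real (n choose 4)"
      by (rule divide_right_mono) simp
    with many show ?case by linarith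
  qed
  show "eventually (\<lambda>n. comb_max Q_comb n / real (n choose 4)
      \<le> real n ^ 4 / real (n choose 4) * (27 / 512)) sequentially"
    using eventually_ge_at_top[of 4]
  proof eventually_elim
    case (elim n)
    have "comb_max Q_comb n \<le> real n ^ 4 / 2 * (27 / 256)"
      unfolding comb_max_def
    proof (rule Max.boundedI[OF finite_comb_counts[OF elim]])
      \<comment> \<open>Any graph with \<open>n\<close> vertices will do here; the random
        construction is merely a source of one.\<close>
      show "{comb_count Q_comb J | J :: nat ugraph. simple_graph J \<and> card (verts J) = n} \<noteq> {}"
        using exists_graph_near_random[of 1 n 0] elim by auto
      fix a assume "a \<in> {comb_count Q_comb J | J :: nat ugraph. simple_graph J \<and> card (verts J) = n}"
      then obtain J :: "nat ugraph" where J: "a = comb_count Q_comb J" "simple_graph J" "card (verts J) = n"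
        by blast
      then have "verts J \<noteq> {}" using elim by auto
      from comb_count_le_max[OF J(2) this] show "a \<le> real n ^ 4 / 2 * (27 / 256)"
        by (simp add: J)
    qed
    then have "comb_max Q_comb n / real (n choose 4) \<le> real n ^ 4 / 2 * (27 / 256) / real (n choose 4)"
      by (rule divide_right_mono) simp
    then show ?case by simp
  qed
  have "(\<lambda>n. real n ^ 4 / real (n choose 4) * (27 / 512)) \<longlonglongrightarrow> 24 * (27 / 512)"
    by (intro tendsto_intros power4_over_choose_tendsto)
  then show "(\<lambda>n. real n ^ 4 / real (n choose 4) * (27 / 512)) \<longlonglongrightarrow> 81 / 64" by simp
qed simp

lemma Sup_rand_density: "(SUP \<sigma>\<in>{0..1}. rand_density 4 Q_comb \<sigma>) = 81 / 64"
proof (rule cSup_eq_maximum)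
  show "81 / 64 \<in> rand_density 4 Q_comb ` {0..1}"
    by (rule image_eqI[of _ _ "3 / 4"]) (simp_all add: rand_density_Q_comb power3_eq_cube)
  fix y assume "y \<in> rand_density 4 Q_comb ` {0..1}"
  then obtain \<sigma> :: real where "y = 12 * \<sigma> ^ 3 * (1 - \<sigma>)"
    by (auto simp: rand_density_Q_comb)
  also have "\<dots> = 12 * (\<sigma> ^ 3 - \<sigma> ^ 4)"
    by (simp add: power3_eq_cube power4_eq_xxxx algebra_simps)
  finally show "y \<le> 81 / 64"
    using cube_minus_fourth_le[of \<sigma>] by simp
qed

theorem theorem2p6:
  shows "(\<forall>\<sigma>::real. (1 + sqrt 2) / 4 \<le> \<sigma> \<and> \<sigma> \<le> 1 \<longrightarrow>
            inducibility_at 4 Q_comb \<sigma> = rand_density 4 Q_comb \<sigma>)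
       \<and> convergent (\<lambda>n. comb_max Q_comb n / real (n choose 4))
       \<and> inducibility 4 Q_comb = (SUP \<sigma>\<in>{0..1}. rand_density 4 Q_comb \<sigma>)
       \<and> (\<forall>\<sigma>::real. (1 + sqrt 2) / 4 \<le> \<sigma> \<and> \<sigma> \<le> 1 \<longrightarrow>
            (\<forall>\<delta>::real. 0 < \<delta> \<and> \<delta> < 1 / 10 ^ 6 \<longrightarrow>
              (\<exists>n0. \<forall>n\<ge>n0. \<forall>J :: nat ugraph.
                 simple_graph J \<and> card (verts J) = n \<and>
                 real (card (edges J)) = \<sigma> * real (n choose 2) \<and>
                 comb_count Q_comb J > (rand_density 4 Q_comb \<sigma> - \<delta>) * real (n choose 4) \<longrightarrow>
                 quasirandom (3 * \<delta> powr (1 / 8)) J \<and> edge_density J = \<sigma>)))"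
proof -
  have nonneg: "0 \<le> \<sigma>" if "(1 + sqrt 2) / 4 \<le> \<sigma>" for \<sigma> :: real
    using that by (smt (verit) divide_nonneg_nonneg real_sqrt_ge_zero)
  have "inducibility_at 4 Q_comb \<sigma> = rand_density 4 Q_comb \<sigma>"
    if "(1 + sqrt 2) / 4 \<le> \<sigma>" "\<sigma> \<le> 1" for \<sigma>
    using that nonneg by (simp add: inducibility_at_Q_comb rand_density_Q_comb)
  moreover have "convergent (\<lambda>n. comb_max Q_comb n / real (n choose 4))"
    using comb_max_density_tendsto by (rule convergentI)
  moreover have "inducibility 4 Q_comb = (SUP \<sigma>\<in>{0..1}. rand_density 4 Q_comb \<sigma>)"
    unfolding inducibility_def Sup_rand_density by (rule limI[OF comb_max_density_tendsto])
  moreover have "\<exists>n0. \<forall>n\<ge>n0. \<forall>J :: nat ugraph.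
      simple_graph J \<and> card (verts J) = n \<and>
      real (card (edges J)) = \<sigma> * real (n choose 2) \<and>
      comb_count Q_comb J > (rand_density 4 Q_comb \<sigma> - \<delta>) * real (n choose 4) \<longrightarrow>
      quasirandom (3 * \<delta> powr (1 / 8)) J \<and> edge_density J = \<sigma>"
    if "(1 + sqrt 2) / 4 \<le> \<sigma>" "\<sigma> \<le> 1" "0 < \<delta>" "\<delta> < 1 / 10 ^ 6" for \<sigma> \<delta>
    using quasirandom_of_near_extremal[OF that] rand_density_Q_comb[OF nonneg[OF that(1)] that(2)]
    by simp
  ultimately show ?thesis by blast
qed

end
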